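(* Let $n\ge1$, $z_0,w_0\in\mathbb{D}$ with $|w_0|=s<r=|z_0|$, and $\gamma_1,\ldots,\gamma_{n-1}\in\overline{\mathbb{D}}$. Set $\gamma_0=w_0/z_0$, and let $w_k=c'_k+\rho'_k z_0\gamma_k/r$ for $k=1,\ldots,n-1$, where $c'_k,\rho'_k$ (and likewise $c'_n,\rho'_n$) are the quantities defined in the context in terms of $z_0,\gamma_0,\gamma_1,\ldots$. Suppose that $h\in\mathcal{H}_0$ satisfies $h(z_0)=w_0$, $h'(z_0)=w_1,\ldots,h^{(n-1)}(z_0)=w_{n-1}$. (1) If $|\gamma_1|<1,\ldots,|\gamma_{j-1}|<1$, $|\gamma_j|=1$, $\gamma_{j+1}=\cdots=\gamma_{n-1}=0$ for some $j\in\{1,\ldots,n-1\}$, then $h^{(n)}(z_0)=c'_n$ and $$h(z)=z\,T_{\gamma_0}\bigl(T_{-z_0}(z)\,T_{\gamma_1}(\cdots T_{-z_0}(z)\,T_{\gamma_{j-1}}(\gamma_jT_{-z_0}(z))\cdots)\bigr).$$ (2) If $|\gamma_1|<1,\ldots,|\gamma_{n-1}|<1$, then the region of values of $h^{(n)}(z_0)$ (i.e. the set of all values $h^{(n)}(z_0)$ as $h$ ranges over all functions in $\mathcal{H}_0$ with $h(z_0)=w_0$ and $h^{(k)}(z_0)=w_k$ for $1\le k\le n-1$) is the closed disk $$\overline{\mathbb{D}}(c'_n,\rho'_n)=\{h^{(n)}_{\gamma,\varepsilon}(z_0):\varepsilon\in\overline{\mathbb{D}}\},$$ where $$h_{\gamma,\varepsilon}(z)=z\,T_{\gamma_0}\bigl(T_{-z_0}(z)\,T_{\gamma_1}(\cdots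 T_{-z_0}(z)\,T_{\gamma_{n-1}}(\varepsilon T_{-z_0}(z))\cdots)\bigr),$$ and every such $h$ has the form $$h(z)=z\,T_{\gamma_0}\bigl(T_{-z_0}(z)\,T_{\gamma_1}(\cdots T_{-z_0}(z)\,T_{\gamma_{n-1}}(T_{-z_0}(z)h^*(z))\cdots)\bigr)$$ for some $h^*\in\mathcal{S}$. Further, $h^{(n)}(z_0)\in\partial\mathbb{D}(c'_n,\rho'_n)$ if and only if $h=h_{\gamma,\varepsilon}$ for some constant $\varepsilon\in\partial\mathbb{D}$.
   Context: Notation. $\mathbb{D}$, $\overline{\mathbb{D}}$ are the open and closed unit disks in $\mathbb{C}$; $\mathbb{D}(c,\rho)$, $\overline{\mathbb{D}}(c,\rho)$ are the open and closed disks with center $c$ and radius $\rho$. $\mathcal{H}$ is the class of analytic self-maps $\mathbb{D}\to\mathbb{D}$ and $\mathcal{H}_0=\{h\in\mathcal{H}:h(0)=0\}$; $\mathcal{S}$ is the class of analytic functions from $\mathbb{D}$ to $\overline{\mathbb{D}}$. For $a\in\mathbb{D}$, $T_a(z)=(z+a)/(1+\bar a z)$. The functions $F_n$, $G_n$. Set $F_1(\gamma_1)=\gamma_1$, $F_2(\gamma_1,\gamma_2)=(1-|\gamma_1|^2)\gamma_2$, and for $n\ge3$ $$F_n(\gamma_1,\ldots,\gamma_n)=(1-|\gamma_1|^2)F_{n-1}(\gamma_2,\ldots,\gamma_n)-\bar\gamma_1\sum_{k=2}^{n-1}F_{n-k}(\gamma_2,\ldots,\gamma_{n-k+1})F_k(\gamma_1,\ldots,\gamma_k).$$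 Set $G_1:=0$ and, for $n\ge2$, $G_n(\gamma_1,\ldots,\gamma_{n-1})=F_n(\gamma_1,\ldots,\gamma_n)-(1-|\gamma_1|^2)\cdots(1-|\gamma_{n-1}|^2)\gamma_n$ (the right side does not depend on $\gamma_n$). Coefficients and Bell polynomials. For $1\le k\le n$, $\alpha_{n,k}=(-1)^{n-k}\dfrac{n!\,(n-1)!}{k!\,(k-1)!\,(n-k)!}$, and $$A_{n,k}(x_1,\ldots,x_{n-k+1})=n!\sum\prod_{i=1}^{n-k+1}\frac{x_i^{j_i}}{(i!)^{j_i}\,j_i!},$$ the sum being over all integers $j_1,\ldots,j_{n-k+1}\ge0$ with $\sum_i j_i=k$ and $\sum_i i\,j_i=n$. The quantities $c_n,\rho_n$. For $n\ge1$, $$\rho_n=\frac{n!\prod_{k=0}^{n-1}(1-|\gamma_k|^2)}{(1-|z_0|^2)^n},\qquad c_n=\frac{1-|\gamma_0|^2}{(1-|z_0|^2)^n}\bigl[n!\,G_n(\gamma_1,\ldots,\gamma_{n-1})-s_{n-1}\bigr],$$ where $s_0:=0$ and, for $n\ge2$, $$s_{n-1}=\sum_{k=1}^{n-1}\alpha_{n,k}\frac{(\overline{z_0})^{n-k}(1-|z_0|^2)^k\,p_k}{1-|\gamma_0|^2}-\sum_{k=2}^{n}k!\,(-\overline{\gamma_0})^{k-1}A_{n,k}(d_1,\ldots,d_{n-k+1}),$$ with $d_k=k!\,F_k(\gamma_1,\ldots,\gamma_k)$ and (recursively) $p_k=c_k+\rho_k\gamma_k$ for $1\le k\le n-1$.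 The quantities $c'_k,\rho'_k$. With $r=|z_0|$, $s=|w_0|$, $\gamma_0=w_0/z_0$: $$c'_1=\frac{w_0}{z_0},\qquad \rho'_1=\frac{r^2-s^2}{r(1-r^2)}\;(=r\rho_1),$$ and for $k\ge2$ $$c'_k=k\,c_{k-1}+k\,\rho_{k-1}\gamma_{k-1}+z_0c_k,\qquad \rho'_k=r\rho_k.$$ *)

theory Defs
  imports "HOL-Complex_Analysis.Complex_Analysis"
begin

definition class_H0 :: "(complex \<Rightarrow> complex) set" where
  "class_H0 = {h. h holomorphic_on ball 0 1 \<and> h ` ball 0 1 \<subseteq> ball 0 1 \<and> h 0 = 0}"

definition class_S :: "(complex \<Rightarrow> complex) set" where
  "class_S = {h. h holomorphic_on ball 0 1 \<and> h ` ball 0 1 \<subseteq> cball 0 1}"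

definition Tm :: "complex \<Rightarrow> complex \<Rightarrow> complex" where
  "Tm a z = (z + a) / (1 + cnj a * z)"

(* Parameter tuples are passed as sequences: Fn n \<gamma> stands for F_n(\<gamma> 1, ..., \<gamma> n), so a
   shifted tuple (\<gamma>_2, \<gamma>_3, ...) is the sequence \<lambda>i. \<gamma> (i + 1). The value at n = 0 is junk. *)
fun Fn :: "nat \<Rightarrow> (nat \<Rightarrow> complex) \<Rightarrow> complex" where
  "Fn n \<gamma> =
    (if n = 0 then 0
     else if n = 1 then \<gamma> 1
     else if n = 2 then of_real (1 - (cmod (\<gamma> 1))\<^sup>2) * \<gamma> 2
     else of_real (1 - (cmod (\<gamma> 1))\<^sup>2) * Fn (n - 1) (\<lambda>i. \<gamma> (i + 1))
          - cnj (\<gamma> 1) * (\<Sum>k = 2..n - 1. Fn (n - k) (\<lambda>i. \<gamma> (i + 1)) * Fn k \<gamma>))"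

declare Fn.simps [simp del]

(* The value does not depend on \<gamma> n: both occurrences of \<gamma> n on the right cancel. *)
definition Gn :: "nat \<Rightarrow> (nat \<Rightarrow> complex) \<Rightarrow> complex" where
  "Gn n \<gamma> =
    (if n \<le> 1 then 0
     else Fn n \<gamma> - of_real (\<Prod>k = 1..n - 1. 1 - (cmod (\<gamma> k))\<^sup>2) * \<gamma> n)"

definition alpha :: "nat \<Rightarrow> nat \<Rightarrow> complex" where
  "alpha n k = (-1) ^ (n - k) * (fact n * fact (n - 1)) / (fact k * fact (k - 1) * fact (n - k))"

definition bell_index :: "nat \<Rightarrow> nat \<Rightarrow> (nat \<Rightarrow> nat) set" where
  "bell_index n k =
    {j \<in> {1..n - k + 1} \<rightarrow>\<^sub>E UNIV.
      (\<Sum>i = 1..n - k + 1. j i) = k \<and> (\<Sum>i = 1..n - k + 1. i * j i) = n}"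

(* Needed for the sum in bell not to collapse to 0. *)
lemma finite_bell_index: "finite (bell_index n k)"
proof (rule finite_subset)
  show "bell_index n k \<subseteq> {1..n - k + 1} \<rightarrow>\<^sub>E {..k}"
  proof
    fix j assume j: "j \<in> bell_index n k"
    have "j i \<le> k" if "i \<in> {1..n - k + 1}" for i
      using member_le_sum[of i "{1..n - k + 1}" j] that j
      by (auto simp: bell_index_def)
    with j show "j \<in> {1..n - k + 1} \<rightarrow>\<^sub>E {..k}"
      by (auto simp: bell_index_def PiE_iff)
  qed
  show "finite ({1..n - k + 1} \<rightarrow>\<^sub>E {..k})"
    by (intro finite_PiE) auto
qed

definition bell :: "nat \<Rightarrow> nat \<Rightarrow> (nat \<Rightarrow> complex) \<Rightarrow> complex" where
  "bell n k x =
    fact n * (\<Sum>j \<in> bell_index n k. \<Prod>i = 1..n - k + 1. x i ^ j i / (fact i ^ j i * fact (j i)))"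

definition rho :: "complex \<Rightarrow> (nat \<Rightarrow> complex) \<Rightarrow> nat \<Rightarrow> real" where
  "rho z0 \<gamma> n =
    fact n * (\<Prod>k<n. 1 - (cmod (\<gamma> k))\<^sup>2) / (1 - (cmod z0)\<^sup>2) ^ n"

definition dn :: "(nat \<Rightarrow> complex) \<Rightarrow> nat \<Rightarrow> complex" where
  "dn \<gamma> k = fact k * Fn k \<gamma>"

(* s_pred z0 \<gamma> n is s_{n-1}. All three functions are meaningful for n \<ge> 1 only. *)
function cn :: "complex \<Rightarrow> (nat \<Rightarrow> complex) \<Rightarrow> nat \<Rightarrow> complex"
  and s_pred :: "complex \<Rightarrow> (nat \<Rightarrow> complex) \<Rightarrow> nat \<Rightarrow> complex"
  and pn :: "complex \<Rightarrow> (nat \<Rightarrow> complex) \<Rightarrow> nat \<Rightarrow> complex" where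
  "cn z0 \<gamma> n =
    of_real ((1 - (cmod (\<gamma> 0))\<^sup>2) / (1 - (cmod z0)\<^sup>2) ^ n) * (fact n * Gn n \<gamma> - s_pred z0 \<gamma> n)"
| "s_pred z0 \<gamma> n =
    (if n \<le> 1 then 0
     else (\<Sum>k = 1..n - 1. alpha n k * (cnj z0 ^ (n - k) * of_real ((1 - (cmod z0)\<^sup>2) ^ k) * pn z0 \<gamma> k)
                             / of_real (1 - (cmod (\<gamma> 0))\<^sup>2))
          - (\<Sum>k = 2..n. fact k * (- cnj (\<gamma> 0)) ^ (k - 1) * bell n k (dn \<gamma>)))"
| "pn z0 \<gamma> k = cn z0 \<gamma> k + of_real (rho z0 \<gamma> k) * \<gamma> k"
  by pat_completeness auto
termination
  by (relation "Wellfounded.measure (case_sum (\<lambda>(z0, \<gamma>, n). 3 * n + 1)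
                  (case_sum (\<lambda>(z0, \<gamma>, n). 3 * n) (\<lambda>(z0, \<gamma>, n). 3 * n + 2)))") auto

declare cn.simps [simp del] s_pred.simps [simp del] pn.simps [simp del]

definition cn' :: "complex \<Rightarrow> complex \<Rightarrow> (nat \<Rightarrow> complex) \<Rightarrow> nat \<Rightarrow> complex" where
  "cn' z0 w0 \<gamma> k =
    (if k = 1 then w0 / z0
     else of_nat k * cn z0 \<gamma> (k - 1) + of_nat k * of_real (rho z0 \<gamma> (k - 1)) * \<gamma> (k - 1)
          + z0 * cn z0 \<gamma> k)"

definition rho' :: "complex \<Rightarrow> complex \<Rightarrow> (nat \<Rightarrow> complex) \<Rightarrow> nat \<Rightarrow> real" where
  "rho' z0 w0 \<gamma> k =
    (if k = 1 then ((cmod z0)\<^sup>2 - (cmod w0)\<^sup>2) / (cmod z0 * (1 - (cmod z0)\<^sup>2))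
     else cmod z0 * rho z0 \<gamma> k)"

(* nest \<gamma> b m u = T_{\<gamma> 0}(b T_{\<gamma> 1}(b T_{\<gamma> 2}( ... b T_{\<gamma> m}(u) ... ))) *)
fun nest :: "(nat \<Rightarrow> complex) \<Rightarrow> complex \<Rightarrow> nat \<Rightarrow> complex \<Rightarrow> complex" where
  "nest \<gamma> b 0 u = Tm (\<gamma> 0) u"
| "nest \<gamma> b (Suc m) u = nest \<gamma> b m (b * Tm (\<gamma> (Suc m)) u)"

definition h_extr :: "complex \<Rightarrow> (nat \<Rightarrow> complex) \<Rightarrow> nat \<Rightarrow> complex \<Rightarrow> complex \<Rightarrow> complex" where
  "h_extr z0 \<gamma> n \<epsilon> z = z * nest \<gamma> (Tm (- z0) z) (n - 1) (\<epsilon> * Tm (- z0) z)"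

definition interpolants :: "nat \<Rightarrow> complex \<Rightarrow> complex \<Rightarrow> (nat \<Rightarrow> complex) \<Rightarrow> (complex \<Rightarrow> complex) set" where
  "interpolants n z0 w0 w =
    {h \<in> class_H0. h z0 = w0 \<and> (\<forall>k \<in> {1..n - 1}. (deriv ^^ k) h z0 = w k)}"

end

theory Submission
  imports Defs
begin

text \<open>Dividing by \<open>z\<close> (Schwarz) turns \<open>h\<close> into a Schur function \<open>f\<close> with \<open>f z0 = \<gamma> 0\<close>. Schur's algorithm
  based at \<open>z0\<close> writes \<open>f = F 0\<close>, \<open>F i = T\<^bsub>\<gamma> i\<^esub> (b * F (i + 1))\<close> with \<open>b = T\<^bsub>-z0\<^esub>\<close>. After the change of
  variable \<open>z = T\<^bsub>z0\<^esub> \<zeta>\<close> the power series of \<open>\<zeta> * F 1\<close> has coefficients \<open>F\<^sub>k (\<gamma> 1, \<dots>, \<gamma> k)\<close>; composing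
  it with \<open>T\<^bsub>\<gamma> 0\<^esub>\<close> on one side (Bell polynomials) and \<open>f\<close> with \<open>T\<^bsub>z0\<^esub>\<close> on the other (the numbers \<open>\<alpha>\<close>)
  identifies the \<open>k\<close>th derivative of \<open>f\<close> at \<open>z0\<close> with \<open>c\<^sub>k + \<rho>\<^sub>k * F k z0\<close>. Since \<open>c\<^sub>k\<close> and \<open>\<rho>\<^sub>k\<close> only involve
  \<open>\<gamma> 0, \<dots>, \<gamma> (k - 1)\<close> and \<open>\<rho>\<^sub>k > 0\<close>, the prescribed derivatives force \<open>F k z0 = \<gamma> k\<close> step by step, while
  \<open>F n\<close> is an arbitrary Schur function. The extremal cases are the maximum modulus principle.\<close>

section \<open>Bell polynomials as coefficients of powers\<close>

lemma finite_compositions: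
  assumes "finite A"
  shows "finite {j \<in> A \<rightarrow>\<^sub>E (UNIV :: nat set). sum j A = k}"
proof (rule finite_subset)
  show "{j \<in> A \<rightarrow>\<^sub>E UNIV. sum j A = k} \<subseteq> A \<rightarrow>\<^sub>E {..k}"
  proof
    fix j :: "'a \<Rightarrow> nat"
    assume j: "j \<in> {j \<in> A \<rightarrow>\<^sub>E UNIV. sum j A = k}"
    then have "j i \<le> k" if "i \<in> A" for i
      using member_le_sum[of i A j] that assms by auto
    with j show "j \<in> A \<rightarrow>\<^sub>E {..k}" by (auto simp: PiE_iff)
  qed
  show "finite (A \<rightarrow>\<^sub>E {..k})"
    using assms by (intro finite_PiE) auto
qed

text \<open>Induction on \<open>A\<close>: the binomial theorem splits off the power
  \<open>t\<close> of the new summand, and a composition of \<open>k\<close> over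
  \<open>insert a A\<close> is a choice of \<open>t\<close> together with a composition of
  \<open>k - t\<close> over \<open>A\<close>.\<close>

lemma multinomial_fps:
  fixes y :: "'b \<Rightarrow> 'a :: field_char_0 fps"
  assumes "finite A"
  shows "(\<Sum>i\<in>A. y i) ^ k =
    (\<Sum>j | j \<in> A \<rightarrow>\<^sub>E UNIV \<and> sum j A = k. fps_const (fact k / (\<Prod>i\<in>A. fact (j i))) * (\<Prod>i\<in>A. y i ^ j i))"
  using assms
proof (induction A arbitrary: k)
  case empty
  show ?case by (cases k) auto
next
  case (insert a A)
  let ?C = "\<lambda>A k. {j \<in> A \<rightarrow>\<^sub>E (UNIV :: nat set). sum j A = k}"
  let ?f = "\<lambda>A k j. fps_const (fact k / (\<Prod>i\<in>A. fact (j i))) * (\<Prod>i\<in>A. y i ^ j i)"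
  have "(\<Sum>i\<in>insert a A. y i) ^ k = (y a + (\<Sum>i\<in>A. y i)) ^ k"
    using insert by simp
  also have "\<dots> = (\<Sum>t\<le>k. of_nat (k choose t) * y a ^ t * (\<Sum>i\<in>A. y i) ^ (k - t))"
    by (rule binomial_ring)
  also have "\<dots> = (\<Sum>t\<le>k. \<Sum>j\<in>?C A (k - t). of_nat (k choose t) * y a ^ t * ?f A (k - t) j)"
    unfolding insert.IH sum_distrib_left by simp
  also have "\<dots> = (\<Sum>(t, j)\<in>(SIGMA t:{..k}. ?C A (k - t)). of_nat (k choose t) * y a ^ t * ?f A (k - t) j)"
    using finite_compositions[OF insert.hyps(1)] by (intro sum.Sigma) auto
  also have "\<dots> = (\<Sum>j\<in>?C (insert a A) k. ?f (insert a A) k j)"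
  \<comment> \<open>The inverse map resets \<open>a\<close> to \<open>undefined\<close>, because
    functions in the extensional space over \<open>A\<close> have that value outside
    \<open>A\<close>.\<close>
  proof (rule sum.reindex_bij_witness[where j = "\<lambda>(t, j). j(a := t)" and i = "\<lambda>j. (j a, j(a := undefined))"])
    fix tj assume *: "tj \<in> (SIGMA t:{..k}. ?C A (k - t))"
    obtain t j where tj: "tj = (t, j)" by force
    have tk: "t \<le> k" and j: "j \<in> A \<rightarrow>\<^sub>E UNIV" "sum j A = k - t" using * tj by auto
    have ja: "j a = undefined" using j insert.hyps by (auto simp: PiE_iff extensional_def)
    have cA: "(\<Sum>i\<in>A. (j(a := t)) i) = sum j A" using insert.hyps by (intro sum.cong) auto
    have pA: "(\<Prod>i\<in>A. y i ^ (j(a := t)) i) = (\<Prod>i\<in>A. y i ^ j i)"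
      "(\<Prod>i\<in>A. fact ((j(a := t)) i)) = (\<Prod>i\<in>A. fact (j i) :: 'a)"
      using insert.hyps by (auto intro!: prod.cong)
    show "(case (case tj of (t, j) \<Rightarrow> j(a := t)) of j \<Rightarrow> (j a, j(a := undefined))) = tj"
      using ja tj by auto
    show "(case tj of (t, j) \<Rightarrow> j(a := t)) \<in> ?C (insert a A) k"
      using j tk insert.hyps cA tj by (auto simp: PiE_iff extensional_def)
    have "fps_const (fact k / (\<Prod>i\<in>insert a A. fact ((j(a := t)) i)) :: 'a) =
      of_nat (k choose t) * fps_const (fact (k - t) / (\<Prod>i\<in>A. fact (j i)))"
      unfolding fps_of_nat[symmetric] fps_const_mult
      using insert.hyps by (simp add: pA[simplified] binomial_fact tk)
    then show "?f (insert a A) k (case tj of (t, j) \<Rightarrow> j(a := t)) =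
        (case tj of (t, j) \<Rightarrow> of_nat (k choose t) * y a ^ t * ?f A (k - t) j)"
      using insert.hyps pA by (simp add: tj mult_ac)
  next
    fix j assume j: "j \<in> ?C (insert a A) k"
    have "sum j (insert a A) = j a + sum j A" using insert.hyps by simp
    moreover have "(\<Sum>i\<in>A. (j(a := undefined)) i) = sum j A" using insert.hyps by (intro sum.cong) auto
    ultimately show "(j a, j(a := undefined)) \<in> (SIGMA t:{..k}. ?C A (k - t))"
      using j insert.hyps by (auto simp: PiE_iff extensional_def)
  qed auto
  finally show ?case by simp
qed

text \<open>In a product of \<open>k\<close> factors of total degree \<open>n\<close>, each factor
  has degree at least 1, so none has degree above \<open>n + 1 - k\<close>. This justifies
  truncating a series before it is raised to a power.\<close>

lemma fps_nth_power_cong: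
  fixes P Q :: "'a :: comm_ring_1 fps"
  assumes "fps_nth P 0 = 0" "fps_nth Q 0 = 0" "\<And>i. i \<le> n + 1 - k \<Longrightarrow> fps_nth P i = fps_nth Q i" "1 \<le> k"
  shows "fps_nth (P ^ k) n = fps_nth (Q ^ k) n"
  using assms
proof (induction k arbitrary: n)
  case 0
  then show ?case by simp
next
  case (Suc k)
  show ?case
  proof (cases "k = 0")
    case True
    then show ?thesis using Suc.prems(3)[of n] by simp
  next
    case False
    have "fps_nth P i * fps_nth (P ^ k) (n - i) = fps_nth Q i * fps_nth (Q ^ k) (n - i)" if "i \<le> n" for i
    proof (cases "i = 0 \<or> n - i < k")
      case True
      then show ?thesis
      proof
        assume "n - i < k"
        with Suc.prems(1,2) have "fps_nth (P ^ k) (n - i) = 0" "fps_nth (Q ^ k) (n - i) = 0"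
          using startsby_zero_power_prefix by blast+
        then show ?thesis by simp
      qed (simp add: Suc.prems)
    next
      case *: False
      have "fps_nth (P ^ k) (n - i) = fps_nth (Q ^ k) (n - i)"
        using * False by (intro Suc.IH Suc.prems(1,2,3)) auto
      then show ?thesis using Suc.prems(3)[of i] * that by auto
    qed
    then show ?thesis by (simp add: fps_mult_nth)
  qed
qed

lemma fps_const_prod: "(\<Prod>i\<in>A. fps_const (f i)) = fps_const (\<Prod>i\<in>A. f i :: 'a :: comm_ring_1)"
  by (induction A rule: infinite_finite_induct) simp_all

text \<open>The exponential generating function of the partial Bell polynomials. The series is
  truncated at degree \<open>n - k + 1\<close> and its power expanded by the multinomial theorem; a
  monomial has degree \<open>n\<close> exactly if \<open>j\<close> meets the second condition of
  \<open>bell_index\<close>.\<close>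

lemma bell_eq_fps_nth:
  assumes "1 \<le> k" "k \<le> n"
  shows "fact k * bell n k x = fact n * fps_nth (Abs_fps (\<lambda>i. if i = 0 then 0 else x i / fact i) ^ k) n"
proof -
  let ?A = "{1..n - k + 1}"
  let ?y = "\<lambda>i. fps_const (x i / fact i) * fps_X ^ i"
  have "fps_nth (\<Sum>i\<in>?A. ?y i) m = (\<Sum>i\<in>?A. if m = i then x i / fact i else 0)" for m
    unfolding fps_sum_nth by (intro sum.cong) auto
  then have nth: "fps_nth (\<Sum>i\<in>?A. ?y i) m = (if m \<in> ?A then x m / fact m else 0)" for m
    by simp
  have "fps_nth (Abs_fps (\<lambda>i. if i = 0 then 0 else x i / fact i) ^ k) n = fps_nth ((\<Sum>i\<in>?A. ?y i) ^ k) n"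
  proof (rule fps_nth_power_cong)
    show "fps_nth (Abs_fps (\<lambda>i. if i = 0 then 0 else x i / fact i)) i = fps_nth (\<Sum>i\<in>?A. ?y i) i"
      if "i \<le> n + 1 - k" for i
      unfolding nth using that assms by auto
    show "fps_nth (\<Sum>i\<in>?A. ?y i) 0 = 0" unfolding nth by simp
  qed (use assms in simp_all)
  also have "\<dots> = (\<Sum>j | j \<in> ?A \<rightarrow>\<^sub>E UNIV \<and> sum j ?A = k.
      fps_nth (fps_const (fact k / (\<Prod>i\<in>?A. fact (j i))) * (\<Prod>i\<in>?A. ?y i ^ j i)) n)"
    by (subst multinomial_fps) (auto simp: fps_sum_nth)
  also have "\<dots> = (\<Sum>j | j \<in> ?A \<rightarrow>\<^sub>E UNIV \<and> sum j ?A = k. if (\<Sum>i\<in>?A. i * j i) = n then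
       fact k * (\<Prod>i\<in>?A. x i ^ j i / (fact i ^ j i * fact (j i))) else 0)"
  proof (intro sum.cong refl)
    fix j :: "nat \<Rightarrow> nat"
    have "(\<Prod>i\<in>?A. ?y i ^ j i) = (\<Prod>i\<in>?A. fps_const ((x i / fact i) ^ j i)) * (\<Prod>i\<in>?A. fps_X ^ (i * j i))"
      by (simp add: power_mult_distrib prod.distrib power_mult fps_const_power)
    also have "(\<Prod>i\<in>?A. fps_const ((x i / fact i) ^ j i)) = fps_const (\<Prod>i\<in>?A. (x i / fact i) ^ j i)"
      by (rule fps_const_prod)
    also have "(\<Prod>i\<in>?A. fps_X ^ (i * j i)) = (fps_X :: complex fps) ^ (\<Sum>i\<in>?A. i * j i)"
      by (rule power_sum[symmetric])
    finally show "fps_nth (fps_const (fact k / (\<Prod>i\<in>?A. fact (j i))) * (\<Prod>i\<in>?A. ?y i ^ j i)) n = 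
       (if (\<Sum>i\<in>?A. i * j i) = n then fact k * (\<Prod>i\<in>?A. x i ^ j i / (fact i ^ j i * fact (j i))) else 0)"
      by (simp add: prod.distrib prod_dividef power_divide mult_ac)
  qed
  also have "\<dots> = (\<Sum>j\<in>bell_index n k. fact k * (\<Prod>i\<in>?A. x i ^ j i / (fact i ^ j i * fact (j i))))"
    using finite_compositions[of ?A k]
    by (subst sum.If_cases) (auto simp: bell_index_def intro!: sum.cong)
  finally show ?thesis unfolding bell_def by (simp add: sum_distrib_left mult_ac)
qed

section \<open>Dependence on the parameters\<close>

lemma Fn_1 [simp]: "Fn (Suc 0) \<gamma> = \<gamma> 1" "Fn 0 \<gamma> = 0"
  by (simp_all add: Fn.simps)

text \<open>At \<open>n = 2\<close> the sum is empty, so the recursion absorbs the separate clause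
  for 2.\<close>

lemma Fn_rec:
  assumes "n \<ge> 2"
  shows "Fn n \<gamma> = of_real (1 - (cmod (\<gamma> 1))\<^sup>2) * Fn (n - 1) (\<lambda>i. \<gamma> (i + 1))
          - cnj (\<gamma> 1) * (\<Sum>k = 2..n - 1. Fn (n - k) (\<lambda>i. \<gamma> (i + 1)) * Fn k \<gamma>)"
  using assms by (subst Fn.simps) (auto simp: numeral_2_eq_2)

text \<open>In the recursion \<gamma>_n occurs only in the first term, as last entry of the shifted
  sequence; the sum stops at index \<open>n - 1\<close>. Hence \<open>Fn n\<close> is affine in its
  last argument, and each step of the recursion multiplies the slope by one factor 1 -
  |\<gamma>_k|^2.\<close>

lemma Fn_diff_last:
  assumes "n \<ge> 1" "\<And>i. i < n \<Longrightarrow> i \<ge> 1 \<Longrightarrow> \<gamma> i = \<gamma>' i"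
  shows "Fn n \<gamma> - Fn n \<gamma>' = of_real (\<Prod>k = 1..n - 1. 1 - (cmod (\<gamma> k))\<^sup>2) * (\<gamma> n - \<gamma>' n)"
  using assms
proof (induction n arbitrary: \<gamma> \<gamma>' rule: less_induct)
  case (less n)
  \<comment> \<open>If the last entries agree as well, the induction hypothesis says that the
    difference is zero.\<close>
  have cong: "Fn m \<delta> = Fn m \<delta>'" if "m < n" "\<And>i. 1 \<le> i \<Longrightarrow> i \<le> m \<Longrightarrow> \<delta> i = \<delta>' i" for m \<delta> \<delta>'
  proof (cases "m = 0")
    case False
    then show ?thesis using less.IH[OF that(1), of \<delta> \<delta>'] that by auto
  qed simp
  show ?case
  proof (cases "n = 1")
    case True
    then show ?thesis by simp
  next
    case False
    then have n: "n \<ge> 2" using less.prems by simp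
    have g1: "\<gamma>' 1 = \<gamma> 1" using less.prems(2)[of 1] n by simp
    have "Fn (n - k) (\<lambda>i. \<gamma> (i + 1)) * Fn k \<gamma> = Fn (n - k) (\<lambda>i. \<gamma>' (i + 1)) * Fn k \<gamma>'"
      if "k \<in> {2..n - 1}" for k
      using that by (intro arg_cong2[of _ _ _ _ "(*)"] cong less.prems(2)) auto
    then have "(\<Sum>k = 2..n - 1. Fn (n - k) (\<lambda>i. \<gamma> (i + 1)) * Fn k \<gamma>) =
        (\<Sum>k = 2..n - 1. Fn (n - k) (\<lambda>i. \<gamma>' (i + 1)) * Fn k \<gamma>')"
      by (rule sum.cong[OF refl])
    then have "Fn n \<gamma> - Fn n \<gamma>' = of_real (1 - (cmod (\<gamma> 1))\<^sup>2) *
        (Fn (n - 1) (\<lambda>i. \<gamma> (i + 1)) - Fn (n - 1) (\<lambda>i. \<gamma>' (i + 1)))"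
      unfolding Fn_rec[OF n] g1 by (simp add: algebra_simps)
    also have "Fn (n - 1) (\<lambda>i. \<gamma> (i + 1)) - Fn (n - 1) (\<lambda>i. \<gamma>' (i + 1)) =
        of_real (\<Prod>k = 1..n - 2. 1 - (cmod (\<gamma> (k + 1)))\<^sup>2) * (\<gamma> n - \<gamma>' n)"
      using less.IH[of "n - 1" "\<lambda>i. \<gamma> (i + 1)" "\<lambda>i. \<gamma>' (i + 1)"] less.prems(2) n
      by (simp add: numeral_2_eq_2 Suc_diff_Suc)
    also have "(\<Prod>k = 1..n - 2. 1 - (cmod (\<gamma> (k + 1)))\<^sup>2) = (\<Prod>k = 2..n - 1. 1 - (cmod (\<gamma> k))\<^sup>2)"
      using n prod.shift_bounds_cl_nat_ivl[of "\<lambda>k. 1 - (cmod (\<gamma> k))\<^sup>2" 1 1 "n - 2"]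
      by (simp add: numeral_2_eq_2 Suc_diff_Suc)
    also have "of_real (1 - (cmod (\<gamma> 1))\<^sup>2) * (of_real \<dots> * (\<gamma> n - \<gamma>' n)) =
        of_real (\<Prod>k = 1..n - 1. 1 - (cmod (\<gamma> k))\<^sup>2) * (\<gamma> n - \<gamma>' n)"
      using n by (subst prod.atLeast_Suc_atMost[of 1]) (auto simp: numeral_2_eq_2)
    finally show ?thesis .
  qed
qed

lemma Fn_cong:
  assumes "\<And>i. 1 \<le> i \<Longrightarrow> i \<le> n \<Longrightarrow> \<gamma> i = \<gamma>' i"
  shows "Fn n \<gamma> = Fn n \<gamma>'"
proof (cases "n = 0")
  case False
  then show ?thesis using Fn_diff_last[of n \<gamma> \<gamma>'] assms by auto
qed simp

lemma Gn_cong: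
  assumes "\<And>i. 1 \<le> i \<Longrightarrow> i < n \<Longrightarrow> \<gamma> i = \<gamma>' i"
  shows "Gn n \<gamma> = Gn n \<gamma>'"
proof (cases "n \<le> 1")
  case False
  have p: "(\<Prod>k = 1..n - 1. 1 - (cmod (\<gamma>' k))\<^sup>2) = (\<Prod>k = 1..n - 1. 1 - (cmod (\<gamma> k))\<^sup>2)"
    using assms False by (intro prod.cong) auto
  show ?thesis using Fn_diff_last[of n \<gamma> \<gamma>'] assms False
    by (simp add: Gn_def p[simplified] algebra_simps)
qed (simp add: Gn_def)

lemma Fn_eq_Gn:
  assumes "n \<ge> 1"
  shows "Fn n \<gamma> = Gn n \<gamma> + of_real (\<Prod>k = 1..n - 1. 1 - (cmod (\<gamma> k))\<^sup>2) * \<gamma> n"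
proof (cases "n = 1")
  case False
  then show ?thesis using assms by (simp add: Gn_def)
qed (simp add: Gn_def)

lemma bell_cong:
  assumes "\<And>i. 1 \<le> i \<Longrightarrow> i \<le> n - k + 1 \<Longrightarrow> x i = x' i"
  shows "bell n k x = bell n k x'"
  unfolding bell_def using assms by (intro arg_cong[where f = "(*) _"] sum.cong prod.cong) auto

lemma rho_cong: "(\<And>i. i < n \<Longrightarrow> \<gamma> i = \<gamma>' i) \<Longrightarrow> rho z0 \<gamma> n = rho z0 \<gamma>' n"
  unfolding rho_def by (intro arg_cong2[where f = "(/)"] arg_cong2[where f = "(*)"] prod.cong) auto

text \<open>Allows the entry \<open>\<gamma> n\<close> to be overwritten by whatever value a given
  function attains, without moving the centre of the disk.\<close>

lemma cn_cong:
  assumes "n \<ge> 1" "\<And>i. i < n \<Longrightarrow> \<gamma> i = \<gamma>' i"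
  shows "cn z0 \<gamma> n = cn z0 \<gamma>' n"
  using assms
proof (induction n rule: less_induct)
  case (less n)
  have pn: "pn z0 \<gamma> k = pn z0 \<gamma>' k" if "k \<in> {1..n - 1}" for k
    using that less.IH[of k] less.prems(2) rho_cong[of k \<gamma> \<gamma>']
    by (auto simp: pn.simps)
  have g0: "\<gamma> 0 = \<gamma>' 0" using less.prems by simp
  have b: "bell n k (dn \<gamma>) = bell n k (dn \<gamma>')" if "k \<in> {2..n}" for k
    using that less.prems(2) by (intro bell_cong) (auto simp: dn_def intro!: Fn_cong)
  have "s_pred z0 \<gamma> n = s_pred z0 \<gamma>' n"
    unfolding s_pred.simps[of z0 _ n] g0
    by (intro if_cong refl arg_cong2[where f = "(-)"] sum.cong) (auto simp: pn b)
  moreover have "Gn n \<gamma> = Gn n \<gamma>'" using less.prems by (intro Gn_cong) auto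
  ultimately show ?case by (simp add: cn.simps g0)
qed

text \<open>The defining relation of \<open>p\<^sub>n\<close>, read as the equality of two expansions of the \<open>n\<close>th
  derivative at \<open>0\<close> of \<open>f \<circ> T\<^bsub>z0\<^esub> = T\<^bsub>\<gamma> 0\<^esub> \<circ> \<phi>\<close>, where \<open>\<phi>\<close> has the coefficients \<open>F\<^sub>k\<close>.\<close>
lemma pn_sum:
  assumes "n \<ge> 1" "cmod (\<gamma> 0) < 1" "cmod z0 < 1"
  shows "(\<Sum>k = 1..n. alpha n k * (cnj z0 ^ (n - k) * of_real ((1 - (cmod z0)\<^sup>2) ^ k) * pn z0 \<gamma> k)) =
    of_real (1 - (cmod (\<gamma> 0))\<^sup>2) * (\<Sum>k = 1..n. fact k * (- cnj (\<gamma> 0)) ^ (k - 1) * bell n k (dn \<gamma>))"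
proof -
  let ?t = "\<lambda>k. alpha n k * (cnj z0 ^ (n - k) * of_real ((1 - (cmod z0)\<^sup>2) ^ k) * pn z0 \<gamma> k)"
  let ?u = "\<lambda>k. fact k * (- cnj (\<gamma> 0)) ^ (k - 1) * bell n k (dn \<gamma>)"
  define a :: complex where "a = of_real (1 - (cmod (\<gamma> 0))\<^sup>2)"
  define b :: complex where "b = of_real ((1 - (cmod z0)\<^sup>2) ^ n)"
  have "(cmod (\<gamma> 0))\<^sup>2 < 1" "(cmod z0)\<^sup>2 < 1"
    using assms(2,3) by (simp_all add: abs_square_less_1)
  then have ab: "a \<noteq> 0" "b \<noteq> 0"
    unfolding a_def b_def of_real_eq_0_iff by auto
  \<comment> \<open>The factor \<open>k = 0\<close> of the product in \<open>rho\<close> is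
    \<open>a\<close>; the remaining factors are the slope of \<open>Fn n\<close> in its last
    argument, so \<open>Gn n\<close> and \<open>\<gamma> n\<close> recombine to
    \<open>Fn n\<close>.\<close>
  have "{..<n} = insert 0 {1..n - 1}" using assms by auto
  then have rho: "of_real (rho z0 \<gamma> n) = a / b * fact n * of_real (\<Prod>k = 1..n - 1. 1 - (cmod (\<gamma> k))\<^sup>2)"
    by (simp add: rho_def a_def b_def)
  have cn: "cn z0 \<gamma> n = a / b * (fact n * Gn n \<gamma> - s_pred z0 \<gamma> n)"
    by (subst cn.simps) (simp add: a_def b_def)
  have "pn z0 \<gamma> n = a / b * (fact n * Fn n \<gamma> - s_pred z0 \<gamma> n)"
    unfolding pn.simps[of _ _ n] rho cn Fn_eq_Gn[OF assms(1)] by (simp add: algebra_simps)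
  then have pn: "b * pn z0 \<gamma> n = a * (fact n * Fn n \<gamma>) - a * s_pred z0 \<gamma> n"
    using ab by (simp add: field_simps)
  \<comment> \<open>For \<open>n = 1\<close> both sums are empty, in agreement with s_0 = 0.\<close>
  have s: "a * s_pred z0 \<gamma> n = (\<Sum>k = 1..n - 1. ?t k) - a * (\<Sum>k = 2..n. ?u k)"
  proof (cases "n = 1")
    case True
    then show ?thesis by (simp add: s_pred.simps)
  next
    case False
    then show ?thesis using assms ab
      by (subst s_pred.simps) (simp add: right_diff_distrib sum_divide_distrib[symmetric] a_def[symmetric] del: of_real_diff)
  qed
  \<comment> \<open>The sum in \<open>s_pred\<close> starts at \<open>k = 2\<close>; the missing
    term \<open>k = 1\<close> is the contribution of \<open>Fn n\<close>.\<close>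
  have b1: "bell n 1 (dn \<gamma>) = fact n * Fn n \<gamma>"
    using bell_eq_fps_nth[of 1 n "dn \<gamma>"] assms(1) by (simp add: dn_def)
  have "?t n = b * pn z0 \<gamma> n" using assms by (simp add: alpha_def b_def)
  moreover have "(\<Sum>k = 1..n. ?t k) = (\<Sum>k = 1..n - 1. ?t k) + ?t n"
    using assms by (cases n) auto
  moreover have "(\<Sum>k = 1..n. ?u k) = ?u 1 + (\<Sum>k = 2..n. ?u k)"
    using assms by (subst sum.atLeast_Suc_atMost) (auto simp: numeral_2_eq_2)
  ultimately show ?thesis
    unfolding a_def[symmetric] using pn s b1 by (simp add: algebra_simps)
qed

section \<open>Disk automorphisms\<close>

text \<open>The sign of the right side compares |z + a| with the modulus of the denominator, which
  gives both the strict and the weak bound on \<open>Tm a z\<close>.\<close>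

lemma Tm_norm_identity:
  "(cmod (1 + cnj a * z))\<^sup>2 - (cmod (z + a))\<^sup>2 = (1 - (cmod a)\<^sup>2) * (1 - (cmod z)\<^sup>2)"
  unfolding cmod_power2 by simp algebra

lemma Tm_denominator_nonzero:
  assumes "cmod a < 1" "cmod z \<le> 1"
  shows "1 + cnj a * z \<noteq> 0"
proof
  assume "1 + cnj a * z = 0"
  then have "cmod (cnj a * z) = 1" by (metis add_eq_0_iff norm_minus_cancel norm_one)
  moreover have "cmod a * cmod z \<le> cmod a" using assms by (simp add: mult_left_le)
  ultimately show False using assms by (simp add: norm_mult)
qed

lemma Tm_norm_le_1:
  assumes "cmod a < 1" "cmod z \<le> 1"
  shows "cmod (Tm a z) \<le> 1"
proof -
  have "0 \<le> (1 - (cmod a)\<^sup>2) * (1 - (cmod z)\<^sup>2)"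
    using assms by (intro mult_nonneg_nonneg) (simp_all add: power_le_one)
  then have "cmod (z + a) \<le> cmod (1 + cnj a * z)"
    unfolding Tm_norm_identity[symmetric] by - (rule power2_le_imp_le, simp_all)
  then show ?thesis using Tm_denominator_nonzero[OF assms]
    by (simp add: Tm_def norm_divide)
qed

lemma Tm_norm_less_1:
  assumes "cmod a < 1" "cmod z < 1"
  shows "cmod (Tm a z) < 1"
proof -
  have "0 < (1 - (cmod a)\<^sup>2) * (1 - (cmod z)\<^sup>2)"
    using assms by (simp add: abs_square_less_1)
  then have "cmod (z + a) < cmod (1 + cnj a * z)"
    unfolding Tm_norm_identity[symmetric] by - (rule power2_less_imp_less, simp_all)
  then show ?thesis using Tm_denominator_nonzero[of a z] assms
    by (simp add: Tm_def norm_divide)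
qed

lemma Tm_minus_Tm:
  assumes "cmod a < 1" "cmod z \<le> 1"
  shows "Tm (- a) (Tm a z) = z"
proof -
  have "cmod (cnj a * a) < 1"
    using assms by (simp add: norm_mult abs_square_less_1 flip: power2_eq_square)
  then have nz: "1 - cnj a * a \<noteq> 0" by force
  define d where "d = 1 + cnj a * z"
  have d: "d \<noteq> 0" using Tm_denominator_nonzero[OF assms] by (simp add: d_def)
  have "Tm (- a) (Tm a z) = ((z + a) / d - a) / (1 - cnj a * ((z + a) / d))"
    by (simp add: Tm_def d_def)
  also have "(z + a) / d - a = z * (1 - cnj a * a) / d"
    using d by (simp add: field_simps) (simp add: d_def algebra_simps)
  also have "1 - cnj a * ((z + a) / d) = (1 - cnj a * a) / d"
    using d by (simp add: field_simps) (simp add: d_def algebra_simps)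
  finally show ?thesis using d nz by simp
qed

lemma Tm_0 [simp]: "Tm a 0 = a"
  by (simp add: Tm_def)

lemma Tm_minus_self [simp]: "Tm (- a) a = 0"
  by (simp add: Tm_def)

lemma Tm_holomorphic [holomorphic_intros]:
  assumes "cmod a < 1" "f holomorphic_on A" "\<And>z. z \<in> A \<Longrightarrow> cmod (f z) \<le> 1"
  shows "(\<lambda>z. Tm a (f z)) holomorphic_on A"
  unfolding Tm_def
  by (intro holomorphic_on_divide holomorphic_on_add holomorphic_on_mult holomorphic_on_const assms(2)
      Tm_denominator_nonzero[OF assms(1)] assms(3))

text \<open>Links the multiplied-out relation used in chains with the quotient form.\<close>

lemma Tm_eq_iff:
  assumes "cmod a < 1" "cmod u \<le> 1"
  shows "w * (1 + cnj a * u) = u + a \<longleftrightarrow> w = Tm a u"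
  unfolding Tm_def by (subst eq_divide_eq) (simp add: Tm_denominator_nonzero[OF assms])

section \<open>Power series of disk automorphisms and of chain relations\<close>

definition fps_Tm0 :: "complex \<Rightarrow> complex fps" where
  "fps_Tm0 a = fps_const (1 - a * cnj a) * fps_X * inverse (1 - fps_const (- cnj a) * fps_X)"

lemma fps_Tm0_nth_0 [simp]: "fps_nth (fps_Tm0 a) 0 = 0"
  by (simp add: fps_Tm0_def)

text \<open>The negative binomial series for (1 + cnj(a) X)^(-k), shifted by \<open>k\<close>. These
  coefficients are the source of the numbers \<open>alpha\<close>. The value \<open>a\<close> at 0
  is removed from \<open>fps_Tm0\<close> so that the series can be substituted into another
  one.\<close>

lemma fps_Tm0_power_nth:
  assumes "k > 0"
  shows "fps_nth (fps_Tm0 a ^ k) n =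
    (if n < k then 0 else (1 - a * cnj a) ^ k * (of_nat ((n - 1) choose (n - k)) * (- cnj a) ^ (n - k)))"
proof -
  have "fps_Tm0 a ^ k = fps_const ((1 - a * cnj a) ^ k) * (fps_X ^ k * inverse ((1 - fps_const (- cnj a) * fps_X) ^ k))"
    unfolding fps_Tm0_def power_mult_distrib fps_const_power fps_inverse_power by (simp only: mult.assoc)
  then show ?thesis
    by (simp only: one_minus_const_fps_X_neg_power'[OF assms] fps_mult_left_const_nth fps_X_power_mult_nth) auto
qed

lemma Tm_has_fps_expansion:
  "(\<lambda>z. Tm a z - a) has_fps_expansion fps_Tm0 a"
proof -
  have "(\<lambda>z. (1 - a * cnj a) * z * inverse (1 - (- cnj a) * z)) has_fps_expansion fps_Tm0 a"
    unfolding fps_Tm0_def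
    by (intro has_fps_expansion_mult has_fps_expansion_inverse has_fps_expansion_diff
        has_fps_expansion_const has_fps_expansion_1 has_fps_expansion_fps_X) simp
  moreover have "eventually (\<lambda>z. 1 + cnj a * z \<noteq> 0) (nhds 0)"
  proof (rule eventually_nhds[THEN iffD2, OF exI[of _ "{z. 1 + cnj a * z \<noteq> 0}"], OF conjI])
    show "open {z. 1 + cnj a * z \<noteq> 0}"
      by (intro open_Collect_neq continuous_intros)
  qed simp
  then have "eventually (\<lambda>z. (1 - a * cnj a) * z * inverse (1 - (- cnj a) * z) = Tm a z - a) (nhds 0)"
    by eventually_elim (simp add: Tm_def field_simps)
  ultimately show ?thesis by (subst has_fps_expansion_cong[OF _ refl, symmetric])
qed

text \<open>Comparing the coefficients of X^k in the relation reproduces \<open>Fn_rec\<close>. The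
  term \<open>l = 1\<close> of the product \<open>Q i * Q (Suc i)\<close> carries |\<gamma>_(i+1)|^2
  and merges with the right side into the factor 1 - |\<gamma>_(i+1)|^2; the terms 2 to
  \<open>k - 1\<close> form the sum.\<close>

lemma chain_fps_nth:
  fixes Q :: "nat \<Rightarrow> complex fps"
  assumes Q0: "\<And>i. Q i $ 0 = 0" and Q1: "\<And>i. i < m \<Longrightarrow> Q i $ 1 = \<gamma> (Suc i)"
    and Q: "\<And>i. Suc i < m \<Longrightarrow> Q i * (1 + fps_const (cnj (\<gamma> (Suc i))) * Q (Suc i)) =
               fps_X * (Q (Suc i) + fps_const (\<gamma> (Suc i)))"
    and "1 \<le> k" "i + k \<le> m"
  shows "Q i $ k = Fn k (\<lambda>l. \<gamma> (l + i))"
  using \<open>1 \<le> k\<close> \<open>i + k \<le> m\<close>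
proof (induction k arbitrary: i rule: less_induct)
  case (less k)
  show ?case
  proof (cases "k = 1")
    case True
    then show ?thesis using less.prems Q1[of i] by simp
  next
    case False
    then have k: "k \<ge> 2" using less.prems by simp
    define c where "c = cnj (\<gamma> (Suc i))"
    have nrm: "complex_of_real (1 - (cmod (\<gamma> (Suc i)))\<^sup>2) = 1 - c * \<gamma> (Suc i)"
      unfolding c_def by (simp add: complex_norm_square mult.commute flip: of_real_power)
    have IH: "Q i $ l = Fn l (\<lambda>l. \<gamma> (l + i))" if "1 \<le> l" "l < k" for l
      using less.IH[of l i] that less.prems by auto
    have IH': "Q (Suc i) $ l = Fn l (\<lambda>l. \<gamma> (l + 1 + i))" if "1 \<le> l" "l < k" for l
      using less.IH[of l "Suc i"] that less.prems by auto
    \<comment> \<open>The end terms \<open>l = 0\<close> and \<open>l = k\<close> vanish, since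
      neither series has a constant term.\<close>
    have split: "{0..k} = insert 0 (insert 1 (insert k {2..k - 1}))" using k by auto
    have "(Q i * Q (Suc i)) $ k = Q i $ 1 * Q (Suc i) $ (k - 1) + (\<Sum>l = 2..k - 1. Q i $ l * Q (Suc i) $ (k - l))"
      unfolding fps_mult_nth split using k Q0 by (subst sum.insert; simp)+
    also have "(\<Sum>l = 2..k - 1. Q i $ l * Q (Suc i) $ (k - l)) =
        (\<Sum>l = 2..k - 1. Fn (k - l) (\<lambda>l. \<gamma> (l + 1 + i)) * Fn l (\<lambda>l. \<gamma> (l + i)))"
      by (intro sum.cong refl, subst IH, force, force, subst IH', force, force, simp)
    also have "Q i $ 1 = \<gamma> (Suc i)" using Q1[of i] less.prems by simp
    also have "Q (Suc i) $ (k - 1) = Fn (k - 1) (\<lambda>l. \<gamma> (l + 1 + i))" using k by (intro IH') auto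
    finally have prod: "(Q i * Q (Suc i)) $ k = \<gamma> (Suc i) * Fn (k - 1) (\<lambda>l. \<gamma> (l + 1 + i)) +
      (\<Sum>l = 2..k - 1. Fn (k - l) (\<lambda>l. \<gamma> (l + 1 + i)) * Fn l (\<lambda>l. \<gamma> (l + i)))" .
    have "Q i + fps_const c * (Q i * Q (Suc i)) = fps_X * (Q (Suc i) + fps_const (\<gamma> (Suc i)))"
      using Q[of i] k less.prems by (simp add: algebra_simps c_def)
    then have "(Q i + fps_const c * (Q i * Q (Suc i))) $ k = (fps_X * (Q (Suc i) + fps_const (\<gamma> (Suc i)))) $ k"
      by simp
    then have "Q i $ k + c * (Q i * Q (Suc i)) $ k = Q (Suc i) $ (k - 1)"
      using k by (simp del: fps_mult_nth add: fps_mult_left_const_nth)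
    also have "Q (Suc i) $ (k - 1) = Fn (k - 1) (\<lambda>l. \<gamma> (l + 1 + i))" using k by (intro IH') auto
    finally show ?thesis
      unfolding prod by (subst Fn_rec[OF k]) (simp add: nrm[simplified] c_def algebra_simps)
  qed
qed

section \<open>Derivatives along a Schur chain\<close>

text \<open>The relation \<open>F i = T\<^bsub>\<gamma> i\<^esub> (b * F (i + 1))\<close> is multiplied out, so that it stays meaningful for
  \<open>\<bar>\<gamma> i\<bar> = 1\<close>, where Schur's algorithm stops and the chain is continued by zeros.\<close>
definition schur_chain :: "complex \<Rightarrow> (nat \<Rightarrow> complex) \<Rightarrow> nat \<Rightarrow> (nat \<Rightarrow> complex \<Rightarrow> complex) \<Rightarrow> bool" where
  "schur_chain z0 \<gamma> m F \<longleftrightarrow>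
    (\<forall>i\<le>m. F i \<in> class_S) \<and>
    (\<forall>i<m. \<forall>z\<in>ball 0 1. F i z * (1 + cnj (\<gamma> i) * (Tm (- z0) z * F (Suc i) z)) =
                           Tm (- z0) z * F (Suc i) z + \<gamma> i)"

lemma schur_chain_eq:
  assumes "schur_chain z0 \<gamma> m F" "i < m" "cmod z < 1"
  shows "F i z * (1 + cnj (\<gamma> i) * (Tm (- z0) z * F (Suc i) z)) = Tm (- z0) z * F (Suc i) z + \<gamma> i"
  using assms unfolding schur_chain_def by (metis mem_ball_0)

lemma has_fps_expansion_transform:
  assumes "f has_fps_expansion P" "eventually (\<lambda>z. f z = g z) (nhds 0)"
  shows "g has_fps_expansion P"
  using assms has_fps_expansion_cong[OF assms(2) refl] by simp

text \<open>The factor \<open>Tm (- z0)\<close> vanishes at \<open>z0\<close>.\<close>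

lemma schur_chain_at_base:
  assumes "schur_chain z0 \<gamma> m F" "i < m" "cmod z0 < 1"
  shows "F i z0 = \<gamma> i"
  using schur_chain_eq[OF assms] by simp

lemma class_S_holomorphic: "f \<in> class_S \<Longrightarrow> f holomorphic_on ball 0 1"
  and class_S_norm_le: "f \<in> class_S \<Longrightarrow> cmod z < 1 \<Longrightarrow> cmod (f z) \<le> 1"
  unfolding class_S_def by (auto simp: image_subset_iff)

lemma class_S_comp_Tm_holomorphic:
  assumes "f \<in> class_S" "cmod a < 1"
  shows "(\<lambda>z. f (Tm a z)) holomorphic_on ball 0 1"
proof -
  have "(f \<circ> Tm a) holomorphic_on ball 0 1"
  proof (rule holomorphic_on_compose_gen)
    show "Tm a holomorphic_on ball 0 1"
      using Tm_holomorphic[OF assms(2), of "\<lambda>z. z" "ball 0 1"] by simp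
    show "f holomorphic_on ball 0 1" by (rule class_S_holomorphic[OF assms(1)])
    show "Tm a ` ball 0 1 \<subseteq> ball 0 1" using Tm_norm_less_1[OF assms(2)] by auto
  qed
  then show ?thesis by (simp add: o_def)
qed

text \<open>Both sides of \<open>F 0 \<circ> T\<^bsub>z0\<^esub> = T\<^bsub>\<gamma> 0\<^esub> \<circ> \<phi>\<close>, with \<open>\<phi> \<zeta> = \<zeta> * F 1 (T\<^bsub>z0\<^esub> \<zeta>)\<close>, are compositions of
  power series; the two sides below are \<open>n!\<close> times their \<open>n\<close>th coefficients.\<close>
lemma schur_chain_higher_deriv_sum:
  assumes chain: "schur_chain z0 \<gamma> m F" and last: "F m z0 = \<gamma> m"
    and z0: "cmod z0 < 1" and g0: "cmod (\<gamma> 0) < 1" and n: "1 \<le> n" "n \<le> m"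
  shows "(\<Sum>k = 1..n. alpha n k * (cnj z0 ^ (n - k) * of_real ((1 - (cmod z0)\<^sup>2) ^ k) * (deriv ^^ k) (F 0) z0)) =
    of_real (1 - (cmod (\<gamma> 0))\<^sup>2) * (\<Sum>k = 1..n. fact k * (- cnj (\<gamma> 0)) ^ (k - 1) * bell n k (dn \<gamma>))"
proof -
  \<comment> \<open>\<open>Q i\<close> expands \<open>Tm (- z0) z * F (Suc i) z\<close> in the
    variable that maps to \<open>z\<close> under \<open>Tm z0\<close>; in this variable the first
    factor is the variable itself.\<close>
  define Q where "Q i = fps_X * fps_expansion (\<lambda>z. F (Suc i) (Tm z0 z)) 0" for i
  define E where "E = fps_expansion (F 0) z0"
  have S: "F i \<in> class_S" if "i \<le> m" for i
    using chain that by (auto simp: schur_chain_def)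
  have at: "F i z0 = \<gamma> i" if "i \<le> m" for i
    using schur_chain_at_base[OF chain _ z0, of i] last that by (cases "i = m") auto
  have Q_exp: "(\<lambda>z. z * F (Suc i) (Tm z0 z)) has_fps_expansion Q i" if "i < m" for i
    unfolding Q_def
    using class_S_comp_Tm_holomorphic[OF S z0, of "Suc i"] that
    by (intro has_fps_expansion_mult has_fps_expansion_fps_X has_fps_expansion_fps_expansion[of "ball 0 1"]) auto
  have Q0: "Q i $ 0 = 0" for i by (simp add: Q_def)
  have Q1: "Q i $ 1 = \<gamma> (Suc i)" if "i < m" for i
    using at[of "Suc i"] that by (simp add: Q_def fps_expansion_def)
  have rel: "F i (Tm z0 z) * (1 + cnj (\<gamma> i) * (z * F (Suc i) (Tm z0 z))) = z * F (Suc i) (Tm z0 z) + \<gamma> i"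
    if "i < m" "z \<in> ball 0 1" for i z
    using schur_chain_eq[OF chain that(1), of "Tm z0 z"] Tm_norm_less_1[OF z0, of z] Tm_minus_Tm[OF z0, of z] that(2)
    by simp
  \<comment> \<open>The chain relation of index \<open>Suc i\<close>, multiplied by the variable so
    that its left factor becomes the function behind \<open>Q i\<close>.\<close>
  have Q_rel: "Q i * (1 + fps_const (cnj (\<gamma> (Suc i))) * Q (Suc i)) = fps_X * (Q (Suc i) + fps_const (\<gamma> (Suc i)))"
    if "Suc i < m" for i
  proof (rule fps_expansion_unique_complex)
    let ?l = "\<lambda>z. z * F (Suc i) (Tm z0 z) * (1 + cnj (\<gamma> (Suc i)) * (z * F (Suc (Suc i)) (Tm z0 z)))"
    let ?r = "\<lambda>z. z * (z * F (Suc (Suc i)) (Tm z0 z) + \<gamma> (Suc i))"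
    show "?l has_fps_expansion Q i * (1 + fps_const (cnj (\<gamma> (Suc i))) * Q (Suc i))"
      using that by (intro has_fps_expansion_mult has_fps_expansion_add has_fps_expansion_const has_fps_expansion_1 Q_exp) auto
    have "?r has_fps_expansion fps_X * (Q (Suc i) + fps_const (\<gamma> (Suc i)))"
      using that by (intro has_fps_expansion_mult has_fps_expansion_add has_fps_expansion_const has_fps_expansion_fps_X Q_exp) auto
    moreover have "eventually (\<lambda>z. z \<in> ball 0 1) (nhds (0 :: complex))"
      by (rule eventually_nhds_in_open) auto
    then have "eventually (\<lambda>z. ?r z = ?l z) (nhds 0)"
      by eventually_elim (simp only: rel[OF that] mult.assoc)
    ultimately show "?l has_fps_expansion fps_X * (Q (Suc i) + fps_const (\<gamma> (Suc i)))"
      by (rule has_fps_expansion_transform)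
  qed
  have Q_nth: "Q 0 $ k = Fn k \<gamma>" if "1 \<le> k" "k \<le> m" for k
    using chain_fps_nth[of Q m \<gamma> k 0, OF Q0 Q1 Q_rel] that by simp
  have an: "F 0 analytic_on {z0}"
    using class_S_holomorphic[OF S[of 0]] z0 by (auto intro!: analytic_at_ball simp: analytic_at intro: exI[of _ "ball 0 1"])
  \<comment> \<open>The outer function is centred at \<open>z0\<close> and the inner one has
    \<open>z0\<close> subtracted, so the inner series has no constant term and may be
    substituted.\<close>
  have "((\<lambda>z. F 0 (z0 + z)) \<circ> (\<lambda>z. Tm z0 z - z0)) has_fps_expansion (E oo fps_Tm0 z0)"
    unfolding E_def by (intro has_fps_expansion_compose analytic_at_imp_has_fps_expansion an Tm_has_fps_expansion) simp
  then have lhs: "(\<lambda>z. F 0 (Tm z0 z) - \<gamma> 0) has_fps_expansion (E oo fps_Tm0 z0) - fps_const (\<gamma> 0)"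
    by (intro has_fps_expansion_diff has_fps_expansion_const) (simp add: o_def)
  have "((\<lambda>z. Tm (\<gamma> 0) z - \<gamma> 0) \<circ> (\<lambda>z. z * F (Suc 0) (Tm z0 z))) has_fps_expansion (fps_Tm0 (\<gamma> 0) oo Q 0)"
    using n by (intro has_fps_expansion_compose Tm_has_fps_expansion Q_exp Q0) auto
  moreover have "eventually (\<lambda>z. z \<in> ball 0 1) (nhds (0 :: complex))"
    by (rule eventually_nhds_in_open) auto
  then have "eventually (\<lambda>z. ((\<lambda>z. Tm (\<gamma> 0) z - \<gamma> 0) \<circ> (\<lambda>z. z * F (Suc 0) (Tm z0 z))) z = F 0 (Tm z0 z) - \<gamma> 0) (nhds 0)"
  proof eventually_elim
    case (elim z)
    have "cmod (F (Suc 0) (Tm z0 z)) \<le> 1"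
      using S[of "Suc 0"] n elim Tm_norm_less_1[OF z0, of z] by (intro class_S_norm_le) auto
    then have "cmod (z * F (Suc 0) (Tm z0 z)) \<le> 1"
      using elim by (simp add: norm_mult mult_le_one)
    then have "F 0 (Tm z0 z) = Tm (\<gamma> 0) (z * F (Suc 0) (Tm z0 z))"
      using rel[of 0 z] n elim Tm_eq_iff[OF g0] by simp
    then show ?case by simp
  qed
  ultimately have "(\<lambda>z. F 0 (Tm z0 z) - \<gamma> 0) has_fps_expansion (fps_Tm0 (\<gamma> 0) oo Q 0)"
    by (rule has_fps_expansion_transform)
  from fps_expansion_unique_complex[OF lhs this]
  have "((E oo fps_Tm0 z0) - fps_const (\<gamma> 0)) $ n = (fps_Tm0 (\<gamma> 0) oo Q 0) $ n" by simp
  then have eq: "(E oo fps_Tm0 z0) $ n = (fps_Tm0 (\<gamma> 0) oo Q 0) $ n" using n by simp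
  have dom: "{0..n} = insert 0 {1..n}" by auto
  \<comment> \<open>The Taylor coefficient of \<open>F 0\<close> supplies 1/k!; with n! and the
    negative binomial coefficient it makes up \<open>alpha n k\<close>, whose sign comes from
    \<open>(- cnj z0) ^ (n - k)\<close>.\<close>
  have fa: "fact n * (E $ k * fps_Tm0 z0 ^ k $ n) =
    alpha n k * (cnj z0 ^ (n - k) * of_real ((1 - (cmod z0)\<^sup>2) ^ k) * (deriv ^^ k) (F 0) z0)"
    if "k \<in> {1..n}" for k
  proof -
    have b: "of_nat (n - 1 choose (n - k)) = (fact (n - 1) / (fact (n - k) * fact (k - 1)) :: complex)"
      using that by (subst binomial_fact) auto
    have c: "complex_of_real ((1 - (cmod z0)\<^sup>2) ^ k) = (1 - z0 * cnj z0) ^ k"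
      by (simp add: complex_norm_square[symmetric])
    have d: "(- cnj z0) ^ (n - k) = (-1) ^ (n - k) * cnj z0 ^ (n - k)" by (rule power_minus)
    show ?thesis
      using that unfolding c fps_Tm0_power_nth[of k, OF that[simplified, THEN conjunct1, unfolded Suc_le_eq]] b d
      by (simp add: E_def fps_expansion_def alpha_def mult_ac)
  qed
  have "fact n * (E oo fps_Tm0 z0) $ n = (\<Sum>k = 1..n. fact n * (E $ k * fps_Tm0 z0 ^ k $ n))"
    unfolding fps_compose_nth dom using n by (simp add: sum_distrib_left)
  also have "\<dots> = (\<Sum>k = 1..n. alpha n k * (cnj z0 ^ (n - k) * of_real ((1 - (cmod z0)\<^sup>2) ^ k) * (deriv ^^ k) (F 0) z0))"
    by (intro sum.cong refl fa)
  finally have A: "fact n * (E oo fps_Tm0 z0) $ n = \<dots>" .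
  have fb: "fact n * (fps_Tm0 (\<gamma> 0) $ k * Q 0 ^ k $ n) =
      of_real (1 - (cmod (\<gamma> 0))\<^sup>2) * (fact k * (- cnj (\<gamma> 0)) ^ (k - 1) * bell n k (dn \<gamma>))"
    if k: "k \<in> {1..n}" for k
  proof -
    have c: "complex_of_real (1 - (cmod (\<gamma> 0))\<^sup>2) = 1 - \<gamma> 0 * cnj (\<gamma> 0)"
      by (simp add: complex_norm_square flip: of_real_power)
    \<comment> \<open>Only coefficients of degree at most \<open>n + 1 - k\<close> matter, and up to
      \<open>m\<close> those of \<open>Q 0\<close> are known to be \<open>Fn\<close>.\<close>
    have "Q 0 ^ k $ n = Abs_fps (\<lambda>i. if i = 0 then 0 else dn \<gamma> i / fact i) ^ k $ n"
      using k n Q0 by (intro fps_nth_power_cong) (auto simp: dn_def Q_nth)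
    then have "fact n * Q 0 ^ k $ n = fact k * bell n k (dn \<gamma>)"
      using bell_eq_fps_nth[of k n "dn \<gamma>"] k by simp
    moreover have "fps_Tm0 (\<gamma> 0) $ k = (1 - \<gamma> 0 * cnj (\<gamma> 0)) * (- cnj (\<gamma> 0)) ^ (k - 1)"
      using fps_Tm0_power_nth[of 1 "\<gamma> 0" k] k by simp
    ultimately show ?thesis unfolding c by simp
  qed
  have "fact n * (fps_Tm0 (\<gamma> 0) oo Q 0) $ n = (\<Sum>k = 1..n. fact n * (fps_Tm0 (\<gamma> 0) $ k * Q 0 ^ k $ n))"
    unfolding fps_compose_nth dom using n by (simp add: sum_distrib_left)
  also have "\<dots> = (\<Sum>k = 1..n. of_real (1 - (cmod (\<gamma> 0))\<^sup>2) * (fact k * (- cnj (\<gamma> 0)) ^ (k - 1) * bell n k (dn \<gamma>)))"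
    by (intro sum.cong refl fb)
  finally show ?thesis using A eq by (simp only: sum_distrib_left)
qed

text \<open>The derivatives and the numbers \<open>pn\<close> satisfy the same triangular linear
  system. By induction the lower terms agree, and the diagonal coefficient (1 - |z0|^2)^n is nonzero
  because \<open>alpha n n\<close> is 1.\<close>

lemma schur_chain_higher_deriv:
  assumes chain: "schur_chain z0 \<gamma> m F" and last: "F m z0 = \<gamma> m"
    and z0: "cmod z0 < 1" and g0: "cmod (\<gamma> 0) < 1" and n: "1 \<le> n" "n \<le> m"
  shows "(deriv ^^ n) (F 0) z0 = pn z0 \<gamma> n"
  using n
proof (induction n rule: less_induct)
  case (less n)
  let ?t = "\<lambda>p k. alpha n k * (cnj z0 ^ (n - k) * of_real ((1 - (cmod z0)\<^sup>2) ^ k) * p k) :: complex"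
  let ?d = "\<lambda>k. (deriv ^^ k) (F 0) z0"
  have "{1..n} = insert n {1..n - 1}" using less.prems by auto
  then have split: "(\<Sum>k = 1..n. ?t p k) = ?t p n + (\<Sum>k = 1..n - 1. ?t p k)" for p
    using less.prems by simp
  have "(\<Sum>k = 1..n. ?t ?d k) = (\<Sum>k = 1..n. ?t (pn z0 \<gamma>) k)"
    using schur_chain_higher_deriv_sum[OF assms(1-4) less.prems] pn_sum[of n \<gamma> z0, OF less.prems(1) g0 z0] by (rule trans[OF _ sym])
  moreover have "(\<Sum>k = 1..n - 1. ?t ?d k) = (\<Sum>k = 1..n - 1. ?t (pn z0 \<gamma>) k)"
    using less.IH less.prems by (intro sum.cong refl arg_cong2[where f = "(*)"]) auto
  ultimately have "?t ?d n = ?t (pn z0 \<gamma>) n" unfolding split by simp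
  moreover have "(cmod z0)\<^sup>2 < 1" using z0 by (simp add: abs_square_less_1)
  then have "complex_of_real ((1 - (cmod z0)\<^sup>2) ^ n) \<noteq> 0" unfolding of_real_eq_0_iff by simp
  ultimately show ?case using less.prems by (simp add: alpha_def del: of_real_power of_real_diff)
qed

section \<open>Schur's algorithm\<close>

lemma class_S_const: "cmod c \<le> 1 \<Longrightarrow> (\<lambda>_. c) \<in> class_S"
  by (auto simp: class_S_def)

lemma class_S_comp_Tm:
  assumes "f \<in> class_S" "cmod a < 1"
  shows "(\<lambda>z. f (Tm a z)) \<in> class_S"
  using class_S_comp_Tm_holomorphic[OF assms] class_S_norm_le[OF assms(1)] Tm_norm_less_1[OF assms(2)]
  unfolding class_S_def by (auto simp: image_subset_iff)

lemma Tm_class_S: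
  assumes "f \<in> class_S" "cmod a < 1"
  shows "(\<lambda>z. Tm a (f z)) \<in> class_S"
  using Tm_holomorphic[OF assms(2) class_S_holomorphic[OF assms(1)]]
    class_S_norm_le[OF assms(1)] Tm_norm_le_1[OF assms(2)]
  unfolding class_S_def by (auto simp: image_subset_iff)

lemma Tm_times_class_S:
  assumes "f \<in> class_S" "cmod a < 1"
  shows "(\<lambda>z. Tm a z * f z) \<in> class_S"
proof -
  have T: "Tm a \<in> class_S"
    using Tm_class_S[OF _ assms(2), of "\<lambda>z. z"] by (auto simp: class_S_def)
  have "cmod (Tm a z * f z) \<le> 1" if "cmod z < 1" for z
    unfolding norm_mult
    by (intro mult_le_one class_S_norm_le[OF T that] class_S_norm_le[OF assms(1) that] norm_ge_zero)
  moreover have "(\<lambda>z. Tm a z * f z) holomorphic_on ball 0 1"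
    by (intro holomorphic_on_mult class_S_holomorphic T assms(1))
  ultimately show ?thesis by (auto simp: class_S_def)
qed

text \<open>The maximum modulus principle, with the maximum attained at the interior point
  \<open>a\<close>.\<close>

lemma class_S_constI:
  assumes "f \<in> class_S" "cmod a < 1" "cmod (f a) = 1" "cmod z < 1"
  shows "f z = f a"
proof -
  have "f constant_on ball 0 1"
    by (rule maximum_modulus_principle[where U = "ball 0 1" and \<xi> = a])
      (use assms class_S_holomorphic class_S_norm_le in auto)
  then show ?thesis using assms unfolding constant_on_def by auto
qed

lemma class_S_norm_less_1:
  assumes "f \<in> class_S" "cmod a < 1" "cmod (f a) < 1" "cmod z < 1"
  shows "cmod (f z) < 1"
  using class_S_constI[OF assms(1,4) _ assms(2)] class_S_norm_le[OF assms(1,4)] assms(3) by force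

text \<open>Schwarz's lemma: away from 0 the quotient is bounded by |f z| \<le> |z|, and at 0 by
  |f'(0)| \<le> 1.\<close>

lemma class_S_divide_id:
  assumes "f \<in> class_S" "f 0 = 0"
  obtains g where "g \<in> class_S" "\<And>z. cmod z < 1 \<Longrightarrow> f z = z * g z"
proof -
  \<comment> \<open>Schwarz's lemma asks for a strict bound; the value 0 at the origin excludes a
    unimodular constant.\<close>
  have lt: "cmod (f z) < 1" if "cmod z < 1" for z
    using class_S_norm_less_1[OF assms(1), of 0 z] assms(2) that by simp
  obtain g where g: "g holomorphic_on ball 0 1" "\<And>z. cmod z < 1 \<Longrightarrow> f z = z * g z" "deriv f 0 = g 0"
    using Schwarz3[OF class_S_holomorphic[OF assms(1)] assms(2)] by blast
  have "cmod (g z) \<le> 1" if "cmod z < 1" for z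
  proof (cases "z = 0")
    case True
    then show ?thesis using Schwarz_Lemma(2)[OF class_S_holomorphic[OF assms(1)] assms(2) lt, of 0] g(3) by simp
  next
    case False
    have "cmod z * cmod (g z) \<le> cmod z * 1"
      using Schwarz_Lemma(1)[OF class_S_holomorphic[OF assms(1)] assms(2) lt that] g(2)[OF that]
      by (simp add: norm_mult)
    then show ?thesis using False by simp
  qed
  then have "g \<in> class_S" using g(1) by (auto simp: class_S_def)
  then show ?thesis using that g(2) by blast
qed

text \<open>Automorphisms move \<open>z0\<close> to 0 in the domain and \<open>f z0\<close> to 0 in
  the range; the resulting function is divided by its variable and both moves are undone.\<close>

lemma schur_step:
  assumes "f \<in> class_S" "cmod z0 < 1" "cmod (f z0) < 1"
  obtains g where "g \<in> class_S" "\<And>z. cmod z < 1 \<Longrightarrow> f z = Tm (f z0) (Tm (- z0) z * g z)"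
proof -
  let ?\<gamma> = "f z0"
  have "(\<lambda>\<zeta>. Tm (- ?\<gamma>) (f (Tm z0 \<zeta>))) \<in> class_S"
    using assms by (intro Tm_class_S class_S_comp_Tm) auto
  then obtain q where q: "q \<in> class_S" "\<And>\<zeta>. cmod \<zeta> < 1 \<Longrightarrow> Tm (- ?\<gamma>) (f (Tm z0 \<zeta>)) = \<zeta> * q \<zeta>"
    using class_S_divide_id[of "\<lambda>\<zeta>. Tm (- ?\<gamma>) (f (Tm z0 \<zeta>))"] by auto
  show ?thesis
  proof (rule that)
    show "(\<lambda>z. q (Tm (- z0) z)) \<in> class_S" using q(1) assms(2) by (intro class_S_comp_Tm) auto
  next
    fix z :: complex assume z: "cmod z < 1"
    have "cmod (Tm (- z0) z) < 1" using assms(2) z by (intro Tm_norm_less_1) auto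
    then have "Tm (- z0) z * q (Tm (- z0) z) = Tm (- ?\<gamma>) (f (Tm z0 (Tm (- z0) z)))"
      using q(2) by simp
    also have "Tm z0 (Tm (- z0) z) = z" using Tm_minus_Tm[of "- z0" z] assms(2) z by simp
    finally have "Tm ?\<gamma> (Tm (- z0) z * q (Tm (- z0) z)) = Tm (- (- ?\<gamma>)) (Tm (- ?\<gamma>) (f z))" by simp
    also have "\<dots> = f z" using assms z class_S_norm_le by (intro Tm_minus_Tm) auto
    finally show "f z = Tm ?\<gamma> (Tm (- z0) z * q (Tm (- z0) z))" by simp
  qed
qed

lemma schur_chain_Tm:
  assumes "schur_chain z0 \<gamma> m F" "i < m" "cmod z0 < 1" "cmod z < 1" "cmod (\<gamma> i) < 1"
  shows "F i z = Tm (\<gamma> i) (Tm (- z0) z * F (Suc i) z)"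
proof -
  have "F (Suc i) \<in> class_S" using assms(1,2) by (auto simp: schur_chain_def)
  then have "(\<lambda>z. Tm (- z0) z * F (Suc i) z) \<in> class_S" using assms(3) by (intro Tm_times_class_S) auto
  then have "cmod (Tm (- z0) z * F (Suc i) z) \<le> 1" using assms(4) class_S_norm_le by blast
  then show ?thesis
    using schur_chain_eq[OF assms(1,2,4)] Tm_eq_iff[OF assms(5)] by blast
qed

lemma schur_chain_Suc:
  assumes chain: "schur_chain z0 \<gamma> m F" and "g \<in> class_S" "cmod z0 < 1" "cmod (\<gamma> m) < 1"
    and F: "\<And>z. cmod z < 1 \<Longrightarrow> F m z = Tm (\<gamma> m) (Tm (- z0) z * g z)"
  shows "schur_chain z0 \<gamma> (Suc m) (F(Suc m := g))"
proof -
  have "cmod (Tm (- z0) z * g z) \<le> 1" if "cmod z < 1" for z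
    using class_S_norm_le[OF Tm_times_class_S[OF assms(2), of "- z0"] that] assms(3) by simp
  then have "F m z * (1 + cnj (\<gamma> m) * (Tm (- z0) z * g z)) = Tm (- z0) z * g z + \<gamma> m" if "cmod z < 1" for z
    using F[OF that] Tm_eq_iff[OF assms(4)] that by blast
  then show ?thesis
    using chain assms(2) by (auto simp: schur_chain_def less_Suc_eq le_Suc_eq)
qed

lemma schur_chain_cong:
  assumes "schur_chain z0 \<gamma> m F" "\<And>i. i < m \<Longrightarrow> \<gamma> i = \<gamma>' i"
  shows "schur_chain z0 \<gamma>' m F"
  using assms by (simp add: schur_chain_def)

text \<open>Schur's algorithm run backwards: starting from \<open>g\<close>, each preceding member
  is defined by the relation, and the disk automorphisms keep it in \<open>class_S\<close>.\<close>

lemma schur_chain_of_tail: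
  assumes "g \<in> class_S" "cmod z0 < 1" "\<And>i. i < m \<Longrightarrow> cmod (\<gamma> i) < 1"
  obtains F where "schur_chain z0 \<gamma> m F" "F m = g"
  using assms
proof (induction m arbitrary: g thesis)
  case 0
  then show ?case by (auto simp: schur_chain_def)
next
  case (Suc m)
  let ?g = "\<lambda>z. Tm (\<gamma> m) (Tm (- z0) z * g z)"
  have "?g \<in> class_S" using Suc.prems by (intro Tm_class_S Tm_times_class_S) auto
  then obtain F where F: "schur_chain z0 \<gamma> m F" "F m = ?g" using Suc.IH Suc.prems by (metis less_SucI)
  have "schur_chain z0 \<gamma> (Suc m) (F(Suc m := g))"
    using Suc.prems F by (intro schur_chain_Suc) auto
  then show ?case using Suc.prems(1) by auto
qed

text \<open>The chain relations as well as c_m and \<rho>_m only see parameters below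
  \<open>m\<close>, so the entry \<open>\<gamma> m\<close> can be replaced by \<open>F m z0\<close>
  before the formula for derivatives is applied.\<close>

lemma schur_chain_higher_deriv_last:
  assumes chain: "schur_chain z0 \<gamma> m F" and z0: "cmod z0 < 1" and g0: "cmod (\<gamma> 0) < 1" and "1 \<le> m"
  shows "(deriv ^^ m) (F 0) z0 = cn z0 \<gamma> m + of_real (rho z0 \<gamma> m) * F m z0"
proof -
  let ?\<gamma> = "\<gamma>(m := F m z0)"
  have "schur_chain z0 ?\<gamma> m F" using chain by (rule schur_chain_cong) simp
  then have "(deriv ^^ m) (F 0) z0 = pn z0 ?\<gamma> m"
    by (rule schur_chain_higher_deriv) (use z0 g0 \<open>1 \<le> m\<close> in auto)
  also have "\<dots> = cn z0 ?\<gamma> m + of_real (rho z0 ?\<gamma> m) * F m z0" by (simp add: pn.simps)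
  also have "cn z0 ?\<gamma> m = cn z0 \<gamma> m" using \<open>1 \<le> m\<close> by (intro cn_cong) auto
  also have "rho z0 ?\<gamma> m = rho z0 \<gamma> m" by (intro rho_cong) auto
  finally show ?thesis .
qed

lemma rho_pos:
  assumes "cmod z0 < 1" "\<And>i. i < m \<Longrightarrow> cmod (\<gamma> i) < 1"
  shows "rho z0 \<gamma> m > 0"
  using assms unfolding rho_def
  by (intro divide_pos_pos mult_pos_pos prod_pos zero_less_power) (auto simp: abs_square_less_1)

text \<open>As \<open>rho\<close> is positive, the affine dependence of the derivative on
  \<open>F m z0\<close> is injective.\<close>

lemma schur_chain_last_at_base:
  assumes "schur_chain z0 \<gamma> m F" "cmod z0 < 1" "\<And>i. i < m \<Longrightarrow> cmod (\<gamma> i) < 1" "1 \<le> m"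
    and "(deriv ^^ m) (F 0) z0 = pn z0 \<gamma> m"
  shows "F m z0 = \<gamma> m"
  using schur_chain_higher_deriv_last[OF assms(1,2) _ assms(4)] rho_pos[of z0 m \<gamma>] assms(2-5)
  by (auto simp: pn.simps)

text \<open>Each prescribed derivative forces the current last member to take the value
  \<open>\<gamma> m\<close> at \<open>z0\<close>; since its modulus is below 1, another Schur step
  is possible.\<close>

lemma schur_chain_exists:
  assumes f: "f \<in> class_S" "f z0 = \<gamma> 0" and z0: "cmod z0 < 1" and "\<And>i. i < m \<Longrightarrow> cmod (\<gamma> i) < 1"
    and "\<And>k. 1 \<le> k \<Longrightarrow> k < m \<Longrightarrow> (deriv ^^ k) f z0 = pn z0 \<gamma> k"
  obtains F where "schur_chain z0 \<gamma> m F" "F 0 = f"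
  using assms(4,5)
proof (induction m arbitrary: thesis)
  case 0
  show ?case by (rule 0(1)[of "\<lambda>_. f"]) (auto simp: schur_chain_def f)
next
  case (Suc m)
  then obtain F where F: "schur_chain z0 \<gamma> m F" "F 0 = f"
    by (metis less_SucI)
  have base: "F m z0 = \<gamma> m"
  proof (cases "m = 0")
    case False
    then show ?thesis
      using Suc.prems(2,3) F(2) by (intro schur_chain_last_at_base[OF F(1) z0]) auto
  qed (use F f in simp)
  have "F m \<in> class_S" using F(1) by (simp add: schur_chain_def)
  then obtain g where g: "g \<in> class_S" "\<And>z. cmod z < 1 \<Longrightarrow> F m z = Tm (\<gamma> m) (Tm (- z0) z * g z)"
    using schur_step[of "F m" z0] z0 base Suc.prems(2)[of m] by auto
  then have "schur_chain z0 \<gamma> (Suc m) (F(Suc m := g))"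
    using F z0 Suc.prems(2) by (intro schur_chain_Suc) auto
  then show ?case using F(2) Suc.prems(1) by auto
qed

lemma schur_chain_nest:
  assumes "schur_chain z0 \<gamma> (Suc m) F" "cmod z0 < 1" "\<And>i. i \<le> m \<Longrightarrow> cmod (\<gamma> i) < 1" "cmod z < 1"
  shows "F 0 z = nest \<gamma> (Tm (- z0) z) m (Tm (- z0) z * F (Suc m) z)"
  using assms(1,3)
proof (induction m)
  case 0
  then show ?case using schur_chain_Tm[OF 0(1) _ assms(2,4)] by simp
next
  case (Suc m)
  have "schur_chain z0 \<gamma> (Suc m) F" using Suc.prems(1) by (auto simp: schur_chain_def)
  then have "F 0 z = nest \<gamma> (Tm (- z0) z) m (Tm (- z0) z * F (Suc m) z)"
    using Suc by simp
  also have "F (Suc m) z = Tm (\<gamma> (Suc m)) (Tm (- z0) z * F (Suc (Suc m)) z)"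
    using schur_chain_Tm[OF Suc.prems(1) _ assms(2,4), of "Suc m"] Suc.prems(2) by simp
  finally show ?case by simp
qed

text \<open>By the maximum modulus principle \<open>F j\<close> is the constant
  \<open>\<gamma> j\<close>. With the next member zero, the multiplied-out relation at
  \<open>j\<close> reads \<open>\<gamma> j = \<gamma> j\<close>, and beyond \<open>j\<close> both
  sides are zero.\<close>

lemma schur_chain_extend_unimodular:
  assumes "schur_chain z0 \<gamma> j F" "cmod z0 < 1" "F j z0 = \<gamma> j" "cmod (\<gamma> j) = 1"
    and "\<And>i. j < i \<Longrightarrow> i < m \<Longrightarrow> \<gamma> i = 0"
  shows "schur_chain z0 \<gamma> m (\<lambda>i. if i \<le> j then F i else (\<lambda>_. 0))"
proof -
  have S: "F i \<in> class_S" if "i \<le> j" for i using assms(1) that by (auto simp: schur_chain_def)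
  have "F j z = \<gamma> j" if "cmod z < 1" for z
    using class_S_constI[OF S, of j z0 z] assms that by simp
  then show ?thesis
    using assms S class_S_const[of 0] schur_chain_eq[OF assms(1)]
    unfolding schur_chain_def by (auto simp: not_le less_Suc_eq_le le_less Suc_le_eq)
qed

section \<open>Multiplication by the variable: from Schur functions to self-maps fixing 0\<close>

lemma higher_deriv_mult_id:
  assumes "f \<in> class_S" "cmod z0 < 1" "1 \<le> k"
  shows "(deriv ^^ k) (\<lambda>z. z * f z) z0 = z0 * (deriv ^^ k) f z0 + of_nat k * (deriv ^^ (k - 1)) f z0"
proof -
  have "(deriv ^^ k) (\<lambda>z. z * f z) z0 =
      (\<Sum>i = 0..k. of_nat (k choose i) * (deriv ^^ i) (\<lambda>z. z) z0 * (deriv ^^ (k - i)) f z0)"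
    using assms class_S_holomorphic by (intro higher_deriv_mult[where S = "ball 0 1"]) auto
  also have "\<dots> = (\<Sum>i\<in>{0, 1}. of_nat (k choose i) * (deriv ^^ i) (\<lambda>z. z) z0 * (deriv ^^ (k - i)) f z0)"
    using assms(3) by (intro sum.mono_neutral_right) (auto simp: higher_deriv_ident)
  also have "\<dots> = z0 * (deriv ^^ k) f z0 + of_nat k * (deriv ^^ (k - 1)) f z0"
    by (simp add: higher_deriv_ident)
  finally show ?thesis .
qed

lemma class_H0_factor:
  assumes "h \<in> class_H0"
  obtains f where "f \<in> class_S" "\<And>z. cmod z < 1 \<Longrightarrow> h z = z * f z"
  by (rule class_S_divide_id[of h]) (use assms in \<open>auto simp: class_H0_def class_S_def image_subset_iff less_imp_le\<close>)

lemma times_id_class_H0: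
  assumes "f \<in> class_S" "\<And>z. cmod z < 1 \<Longrightarrow> h z = z * f z"
  shows "h \<in> class_H0"
proof -
  have "cmod (h z) < 1" if "cmod z < 1" for z
  proof -
    have "cmod z * cmod (f z) \<le> cmod z * 1"
      using class_S_norm_le[OF assms(1) that] by (intro mult_left_mono) auto
    then show ?thesis using assms(2)[OF that] that by (simp add: norm_mult)
  qed
  moreover have "(\<lambda>z. z * f z) holomorphic_on ball 0 1"
    using class_S_holomorphic[OF assms(1)] by (intro holomorphic_on_mult holomorphic_on_ident)
  then have "h holomorphic_on ball 0 1"
    using assms(2) by (subst holomorphic_cong[OF refl]) auto
  ultimately show ?thesis using assms(2)[of 0] by (auto simp: class_H0_def)
qed

lemma higher_deriv_transform_ball:
  assumes "f \<in> class_S" "\<And>z. cmod z < 1 \<Longrightarrow> h z = z * f z" "cmod z0 < 1"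
  shows "(deriv ^^ k) h z0 = (deriv ^^ k) (\<lambda>z. z * f z) z0"
proof (rule higher_deriv_cong_ev)
  have "eventually (\<lambda>z. z \<in> ball 0 1) (nhds z0)" using assms(3) by (intro eventually_nhds_in_open) auto
  then show "eventually (\<lambda>z. h z = z * f z) (nhds z0)" by eventually_elim (simp add: assms(2))
qed simp

section \<open>Interpolants\<close>

lemma schur_chain_higher_deriv_less:
  assumes "schur_chain z0 \<gamma> m F" "cmod z0 < 1" "cmod (\<gamma> 0) < 1" "1 \<le> k" "k < m"
  shows "(deriv ^^ k) (F 0) z0 = pn z0 \<gamma> k"
proof (rule schur_chain_higher_deriv)
  show "schur_chain z0 \<gamma> k F" using assms(1,5) by (auto simp: schur_chain_def)
  show "F k z0 = \<gamma> k" by (rule schur_chain_at_base[OF assms(1,5,2)])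
qed (use assms in auto)

text \<open>Shows that the separate formula for \<open>k = 1\<close> is an instance of the general
  one: 1 - |\<gamma>_0|^2 = (r^2 - s^2)/r^2.\<close>

lemma rho'_eq:
  assumes "z0 \<noteq> 0" "\<gamma> 0 = w0 / z0"
  shows "rho' z0 w0 \<gamma> k = cmod z0 * rho z0 \<gamma> k"
proof (cases "k = 1")
  case True
  have "1 - (cmod (\<gamma> 0))\<^sup>2 = ((cmod z0)\<^sup>2 - (cmod w0)\<^sup>2) / (cmod z0)\<^sup>2"
    using assms by (simp add: norm_divide power_divide diff_divide_distrib)
  then show ?thesis using assms True by (simp add: rho'_def rho_def power2_eq_square)
qed (simp add: rho'_def)

text \<open>Puts the centre into the form given by Leibniz' rule for \<open>z * f z\<close>. For
  \<open>k = 1\<close> the derivative of order \<open>k - 1\<close> is the value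
  \<open>\<gamma> 0\<close>, and c_1 vanishes.\<close>

lemma cn'_eq:
  assumes "1 \<le> k" "\<gamma> 0 = w0 / z0"
  shows "cn' z0 w0 \<gamma> k = z0 * cn z0 \<gamma> k + of_nat k * (if k = 1 then \<gamma> 0 else pn z0 \<gamma> (k - 1))"
proof (cases "k = 1")
  case True
  have "cn z0 \<gamma> 1 = 0" by (simp add: cn.simps s_pred.simps Gn_def)
  then show ?thesis using True assms(2) by (simp add: cn'_def)
qed (use assms in \<open>simp add: cn'_def pn.simps algebra_simps\<close>)

lemma cn'_rho'_eq:
  assumes "1 \<le> k" "z0 \<noteq> 0" "\<gamma> 0 = w0 / z0"
  shows "cn' z0 w0 \<gamma> k + of_real (rho' z0 w0 \<gamma> k) * z0 * \<epsilon> / of_real (cmod z0) =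
    z0 * (cn z0 \<gamma> k + of_real (rho z0 \<gamma> k) * \<epsilon>) + of_nat k * (if k = 1 then \<gamma> 0 else pn z0 \<gamma> (k - 1))"
  unfolding cn'_eq[of k \<gamma> w0 z0, OF assms(1,3)] rho'_eq[of z0 \<gamma> w0, OF assms(2,3)]
  using assms(2) by (simp add: algebra_simps)

text \<open>Leibniz' rule brings in the derivatives of \<open>F 0\<close> of orders \<open>k\<close>
  and \<open>k - 1\<close>; the first is affine in \<open>F k z0\<close>, the second is fixed by the
  parameters below \<open>k\<close>.\<close>

lemma higher_deriv_times_schur_chain:
  assumes chain: "schur_chain z0 \<gamma> n F" and h: "\<And>z. cmod z < 1 \<Longrightarrow> h z = z * F 0 z"
    and z0: "cmod z0 < 1" "z0 \<noteq> 0" and g0: "\<gamma> 0 = w0 / z0" "cmod (\<gamma> 0) < 1" and k: "1 \<le> k" "k \<le> n"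
  shows "(deriv ^^ k) h z0 = cn' z0 w0 \<gamma> k + of_real (rho' z0 w0 \<gamma> k) * z0 * F k z0 / of_real (cmod z0)"
proof -
  have S: "F 0 \<in> class_S" and chain': "schur_chain z0 \<gamma> k F"
    using chain k by (auto simp: schur_chain_def)
  have "(deriv ^^ k) h z0 = z0 * (deriv ^^ k) (F 0) z0 + of_nat k * (deriv ^^ (k - 1)) (F 0) z0"
    using higher_deriv_transform_ball[OF S h z0(1)] higher_deriv_mult_id[OF S z0(1) k(1)] by simp
  also have "(deriv ^^ k) (F 0) z0 = cn z0 \<gamma> k + of_real (rho z0 \<gamma> k) * F k z0"
    by (rule schur_chain_higher_deriv_last[OF chain' z0(1) g0(2) k(1)])
  also have "(deriv ^^ (k - 1)) (F 0) z0 = (if k = 1 then \<gamma> 0 else pn z0 \<gamma> (k - 1))"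
    using schur_chain_higher_deriv_less[OF chain' z0(1) g0(2), of "k - 1"]
      schur_chain_at_base[OF chain' _ z0(1), of 0] k by auto
  finally show ?thesis unfolding cn'_rho'_eq[of k z0 \<gamma> w0, OF k(1) z0(2) g0(1)] .
qed

lemma schur_chain_interpolant:
  assumes "schur_chain z0 \<gamma> n F" "\<And>z. cmod z < 1 \<Longrightarrow> h z = z * F 0 z" "1 \<le> n"
    and "cmod z0 < 1" "z0 \<noteq> 0" "\<gamma> 0 = w0 / z0" "cmod (\<gamma> 0) < 1"
    and w: "\<And>k. k \<in> {1..n - 1} \<Longrightarrow>
           w k = cn' z0 w0 \<gamma> k + of_real (rho' z0 w0 \<gamma> k) * z0 * \<gamma> k / of_real (cmod z0)"
  shows "h \<in> interpolants n z0 w0 w"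
proof -
  have "F 0 \<in> class_S" using assms(1) by (simp add: schur_chain_def)
  then have "h \<in> class_H0" using assms(2) by (rule times_id_class_H0)
  moreover have "h z0 = w0"
    using assms(2)[OF assms(4)] schur_chain_at_base[OF assms(1) _ assms(4), of 0] assms(3,5,6) by simp
  moreover have "(deriv ^^ k) h z0 = w k" if "k \<in> {1..n - 1}" for k
    using higher_deriv_times_schur_chain[OF assms(1,2,4-7), of k] w[OF that]
      schur_chain_at_base[OF assms(1) _ assms(4), of k] that by auto
  ultimately show ?thesis by (simp add: interpolants_def)
qed

text \<open>Leibniz' rule is solved for the highest derivative of \<open>f\<close>, order by order,
  which is possible because \<open>z0\<close> is nonzero.\<close>

lemma interpolant_factor:
  assumes h: "h \<in> interpolants n z0 w0 w"
    and z0: "cmod z0 < 1" "z0 \<noteq> 0" and g0: "\<gamma> 0 = w0 / z0"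
    and w: "\<And>k. k \<in> {1..n - 1} \<Longrightarrow>
           w k = cn' z0 w0 \<gamma> k + of_real (rho' z0 w0 \<gamma> k) * z0 * \<gamma> k / of_real (cmod z0)"
  obtains f where "f \<in> class_S" "\<And>z. cmod z < 1 \<Longrightarrow> h z = z * f z" "f z0 = \<gamma> 0"
    "\<And>k. k \<in> {1..n - 1} \<Longrightarrow> (deriv ^^ k) f z0 = pn z0 \<gamma> k"
proof -
  obtain f where f: "f \<in> class_S" "\<And>z. cmod z < 1 \<Longrightarrow> h z = z * f z"
    using h class_H0_factor[of h] by (auto simp: interpolants_def)
  have "z0 * f z0 = w0" using h f(2)[OF z0(1)] by (simp add: interpolants_def)
  then have f0: "f z0 = \<gamma> 0" using z0(2) unfolding g0 by (metis nonzero_mult_div_cancel_left)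
  have "(deriv ^^ k) f z0 = pn z0 \<gamma> k" if "k \<in> {1..n - 1}" for k
    using that
  proof (induction k rule: less_induct)
    case (less k)
    have "z0 * (deriv ^^ k) f z0 + of_nat k * (deriv ^^ (k - 1)) f z0 = (deriv ^^ k) h z0"
      using higher_deriv_transform_ball[OF f z0(1)] higher_deriv_mult_id[OF f(1) z0(1), of k] less.prems by simp
    also have "\<dots> = w k" using h less.prems by (simp add: interpolants_def)
    also have "\<dots> = z0 * pn z0 \<gamma> k + of_nat k * (if k = 1 then \<gamma> 0 else pn z0 \<gamma> (k - 1))"
      using w[OF less.prems] cn'_rho'_eq[of k z0 \<gamma> w0] z0(2) g0 less.prems by (simp add: pn.simps)
    also have "(if k = 1 then \<gamma> 0 else pn z0 \<gamma> (k - 1)) = (deriv ^^ (k - 1)) f z0"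
    proof (cases "k = 1")
      case False
      then have "k - 1 < k" "k - 1 \<in> {1..n - 1}" using less.prems by auto
      then show ?thesis using less.IH[of "k - 1"] False by simp
    qed (simp add: f0)
    finally show ?case using z0(2) by simp
  qed
  then show ?thesis using that f f0 by blast
qed

theorem theorem3p1:
  fixes n :: nat and z0 w0 :: complex and \<gamma> w :: "nat \<Rightarrow> complex"
  assumes "n \<ge> 1"
    and "z0 \<in> ball 0 1" and "w0 \<in> ball 0 1" and "cmod w0 < cmod z0"
    and "\<And>k. k \<in> {1..n - 1} \<Longrightarrow> \<gamma> k \<in> cball 0 1"
    and "\<gamma> 0 = w0 / z0"
    and "\<And>k. k \<in> {1..n - 1} \<Longrightarrow>
           w k = cn' z0 w0 \<gamma> k + of_real (rho' z0 w0 \<gamma> k) * z0 * \<gamma> k / of_real (cmod z0)"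
  shows
    "(\<forall>h \<in> interpolants n z0 w0 w. \<forall>j \<in> {1..n - 1}.
        (\<forall>k \<in> {1..<j}. cmod (\<gamma> k) < 1) \<and> cmod (\<gamma> j) = 1 \<and> (\<forall>k \<in> {j<..n - 1}. \<gamma> k = 0) \<longrightarrow>
          (deriv ^^ n) h z0 = cn' z0 w0 \<gamma> n \<and>
          (\<forall>z \<in> ball 0 1. h z = z * nest \<gamma> (Tm (- z0) z) (j - 1) (\<gamma> j * Tm (- z0) z)))
     \<and>
     ((\<forall>k \<in> {1..n - 1}. cmod (\<gamma> k) < 1) \<longrightarrow>
        {(deriv ^^ n) h z0 | h. h \<in> interpolants n z0 w0 w}
          = cball (cn' z0 w0 \<gamma> n) (rho' z0 w0 \<gamma> n) \<and>
        cball (cn' z0 w0 \<gamma> n) (rho' z0 w0 \<gamma> n)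
          = {(deriv ^^ n) (h_extr z0 \<gamma> n \<epsilon>) z0 | \<epsilon>. \<epsilon> \<in> cball 0 1} \<and>
        (\<forall>h \<in> interpolants n z0 w0 w.
          \<exists>h' \<in> class_S. \<forall>z \<in> ball 0 1.
            h z = z * nest \<gamma> (Tm (- z0) z) (n - 1) (Tm (- z0) z * h' z)) \<and>
        (\<forall>h \<in> interpolants n z0 w0 w.
          (deriv ^^ n) h z0 \<in> frontier (ball (cn' z0 w0 \<gamma> n) (rho' z0 w0 \<gamma> n)) \<longleftrightarrow>
          (\<exists>\<epsilon> \<in> frontier (ball 0 1). \<forall>z \<in> ball 0 1. h z = h_extr z0 \<gamma> n \<epsilon> z)))"
proof -
  have z0: "cmod z0 < 1" "z0 \<noteq> 0" using assms(2,4) by auto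
  have g0: "\<gamma> 0 = w0 / z0" "cmod (\<gamma> 0) < 1"
    using assms(4,6) z0(2) by (auto simp: norm_divide divide_less_eq)
  note deriv_eq = higher_deriv_times_schur_chain[where ?z0.0 = z0 and ?w0.0 = w0 and \<gamma> = \<gamma> and n = n and k = n, OF _ _ z0 g0 assms(1) order_refl]
  show ?thesis
  proof (intro conjI ballI impI)
    fix h j
    assume h: "h \<in> interpolants n z0 w0 w" and j: "j \<in> {1..n - 1}"
      and "(\<forall>k \<in> {1..<j}. cmod (\<gamma> k) < 1) \<and> cmod (\<gamma> j) = 1 \<and> (\<forall>k \<in> {j<..n - 1}. \<gamma> k = 0)"
    then have le: "\<forall>k \<in> {1..<j}. cmod (\<gamma> k) < 1" and uni: "cmod (\<gamma> j) = 1"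
      and zero: "\<And>k. j < k \<Longrightarrow> k < n \<Longrightarrow> \<gamma> k = 0" by auto
    have lt: "cmod (\<gamma> k) < 1" if "k < j" for k
      using le g0(2) that by (cases "k = 0") auto
    obtain f where f: "f \<in> class_S" "\<And>z. cmod z < 1 \<Longrightarrow> h z = z * f z" "f z0 = \<gamma> 0"
      "\<And>k. k \<in> {1..n - 1} \<Longrightarrow> (deriv ^^ k) f z0 = pn z0 \<gamma> k"
      by (rule interpolant_factor[OF h z0 g0(1) assms(7)]) auto
    obtain F where F: "schur_chain z0 \<gamma> j F" "F 0 = f"
      by (rule schur_chain_exists[of f z0 \<gamma> j]) (use f z0 lt j in auto)
    \<comment> \<open>As \<open>j \<le> n - 1\<close>, the derivative of order \<open>j\<close> is
      still prescribed and determines this value.\<close>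
    have Fj: "F j z0 = \<gamma> j"
      by (rule schur_chain_last_at_base[OF F(1) z0(1) lt]) (use F(2) f(4) j in auto)
    have S: "F j \<in> class_S" using F(1) by (simp add: schur_chain_def)
    \<comment> \<open>The continuation by zeros reaches index \<open>n\<close> with last member 0,
      so the \<open>n\<close>th derivative is the centre.\<close>
    have "schur_chain z0 \<gamma> n (\<lambda>i. if i \<le> j then F i else (\<lambda>_. 0))"
      by (rule schur_chain_extend_unimodular[OF F(1) z0(1) Fj uni zero])
    then show "(deriv ^^ n) h z0 = cn' z0 w0 \<gamma> n"
      using deriv_eq[of "\<lambda>i. if i \<le> j then F i else (\<lambda>_. 0)" h] f(2) F(2) j by auto
    fix z :: complex assume "z \<in> ball 0 1"
    then have z: "cmod z < 1" by simp
    have "F 0 z = nest \<gamma> (Tm (- z0) z) (j - 1) (Tm (- z0) z * F j z)"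
    proof -
      have "cmod (\<gamma> i) < 1" if "i \<le> j - 1" for i using that j by (intro lt) auto
      then show ?thesis
        using schur_chain_nest[of z0 \<gamma> "j - 1" F z, OF _ z0(1) _ z] F(1) j by simp
    qed
    also have "F j z = \<gamma> j" using class_S_constI[OF S z0(1) _ z] Fj uni by simp
    finally show "h z = z * nest \<gamma> (Tm (- z0) z) (j - 1) (\<gamma> j * Tm (- z0) z)"
      using f(2)[OF z] F(2) by (simp add: mult.commute)
  next
    assume "\<forall>k \<in> {1..n - 1}. cmod (\<gamma> k) < 1"
    then have lt: "cmod (\<gamma> k) < 1" if "k < n" for k
      using g0(2) that by (cases "k = 0") auto
    define c \<rho> where "c = cn' z0 w0 \<gamma> n" and "\<rho> = rho' z0 w0 \<gamma> n"
    \<comment> \<open>The unimodular factor z0/r only rotates the parameter, so the distance to the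
      centre \<open>c\<close> depends on the modulus of the parameter alone.\<close>
    define u where "u = z0 / of_real (cmod z0)"
    have u: "cmod u = 1" using z0(2) by (simp add: u_def norm_divide)
    have \<rho>: "\<rho> > 0" using rho_pos[OF z0(1) lt] z0(2) by (simp add: \<rho>_def rho'_eq[of z0 \<gamma> w0, OF z0(2) g0(1)])
    have chain_deriv: "(deriv ^^ n) h z0 = c + of_real \<rho> * u * F n z0"
      if "schur_chain z0 \<gamma> n F" "\<And>z. cmod z < 1 \<Longrightarrow> h z = z * F 0 z" for h F
      using deriv_eq[OF that] by (simp add: c_def \<rho>_def u_def)
    have dist: "dist c (c + of_real \<rho> * u * e) = \<rho> * cmod e" for e
      using \<rho> u by (simp add: dist_norm norm_mult)
    have nest: "F 0 z = nest \<gamma> (Tm (- z0) z) (n - 1) (Tm (- z0) z * F n z)"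
      if "schur_chain z0 \<gamma> n F" "cmod z < 1" for F z
      using schur_chain_nest[of z0 \<gamma> "n - 1" F z] that z0(1) lt assms(1) by simp
    have chain: "\<exists>F. schur_chain z0 \<gamma> n F \<and> (\<forall>z. cmod z < 1 \<longrightarrow> h z = z * F 0 z)"
      if h: "h \<in> interpolants n z0 w0 w" for h
    proof -
      obtain f where f: "f \<in> class_S" "\<And>z. cmod z < 1 \<Longrightarrow> h z = z * f z" "f z0 = \<gamma> 0"
        "\<And>k. k \<in> {1..n - 1} \<Longrightarrow> (deriv ^^ k) f z0 = pn z0 \<gamma> k"
        by (rule interpolant_factor[OF h z0 g0(1) assms(7)]) auto
      obtain F where "schur_chain z0 \<gamma> n F" "F 0 = f"
        by (rule schur_chain_exists[of f z0 \<gamma> n]) (use f z0 lt in auto)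
      then show ?thesis using f(2) by auto
    qed
    \<comment> \<open>The extremal functions are those whose chain ends in the constant
      \<open>\<epsilon>\<close>.\<close>
    have extr: "h_extr z0 \<gamma> n \<epsilon> \<in> interpolants n z0 w0 w"
      "(deriv ^^ n) (h_extr z0 \<gamma> n \<epsilon>) z0 = c + of_real \<rho> * u * \<epsilon>" if \<epsilon>: "cmod \<epsilon> \<le> 1" for \<epsilon>
    proof -
      obtain F where F: "schur_chain z0 \<gamma> n F" "F n = (\<lambda>_. \<epsilon>)"
        by (rule schur_chain_of_tail[OF class_S_const[OF \<epsilon>] z0(1) lt])
      have eq: "h_extr z0 \<gamma> n \<epsilon> z = z * F 0 z" if "cmod z < 1" for z
        using nest[OF F(1) that] F(2) by (simp add: h_extr_def mult.commute)
      show "h_extr z0 \<gamma> n \<epsilon> \<in> interpolants n z0 w0 w"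
        by (rule schur_chain_interpolant[OF F(1) eq assms(1) z0 g0 assms(7)])
      show "(deriv ^^ n) (h_extr z0 \<gamma> n \<epsilon>) z0 = c + of_real \<rho> * u * \<epsilon>"
        using chain_deriv[OF F(1) eq] F(2) by simp
    qed
    have in_disk: "(deriv ^^ n) h z0 \<in> cball c \<rho>" if h: "h \<in> interpolants n z0 w0 w" for h
    proof -
      obtain F where F: "schur_chain z0 \<gamma> n F" "\<And>z. cmod z < 1 \<Longrightarrow> h z = z * F 0 z"
        using chain[OF h] by blast
      have "F n \<in> class_S" using F(1) by (simp add: schur_chain_def)
      then have "\<rho> * cmod (F n z0) \<le> \<rho> * 1"
        using class_S_norm_le[OF _ z0(1)] \<rho> by (intro mult_left_mono) auto
      then show ?thesis using chain_deriv[OF F] dist by simp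
    qed
    have disk_eq: "cball c \<rho> = {(deriv ^^ n) (h_extr z0 \<gamma> n \<epsilon>) z0 | \<epsilon>. \<epsilon> \<in> cball 0 1}"
    proof (intro equalityI subsetI)
      fix p assume p: "p \<in> cball c \<rho>"
      \<comment> \<open>The preimage of \<open>p\<close> under the affine parametrisation of the
        disk.\<close>
      define e where "e = (p - c) / (of_real \<rho> * u)"
      have nz: "of_real \<rho> * u \<noteq> 0" using \<rho> u by auto
      have "cmod e \<le> 1" using p \<rho> u
        by (simp add: e_def norm_divide norm_mult dist_norm norm_minus_commute)
      moreover have "p = c + of_real \<rho> * u * e" using nz by (simp add: e_def)
      ultimately show "p \<in> {(deriv ^^ n) (h_extr z0 \<gamma> n \<epsilon>) z0 | \<epsilon>. \<epsilon> \<in> cball 0 1}"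
        using extr(2)[of e] by (auto intro!: exI[of _ e])
    next
      fix p assume "p \<in> {(deriv ^^ n) (h_extr z0 \<gamma> n \<epsilon>) z0 | \<epsilon>. \<epsilon> \<in> cball 0 1}"
      then obtain \<epsilon> where "cmod \<epsilon> \<le> 1" "p = (deriv ^^ n) (h_extr z0 \<gamma> n \<epsilon>) z0" by auto
      then show "p \<in> cball c \<rho>" using in_disk[OF extr(1)] by simp
    qed
    show "cball (cn' z0 w0 \<gamma> n) (rho' z0 w0 \<gamma> n)
          = {(deriv ^^ n) (h_extr z0 \<gamma> n \<epsilon>) z0 | \<epsilon>. \<epsilon> \<in> cball 0 1}"
      using disk_eq unfolding c_def \<rho>_def .
    show "{(deriv ^^ n) h z0 | h. h \<in> interpolants n z0 w0 w} = cball (cn' z0 w0 \<gamma> n) (rho' z0 w0 \<gamma> n)"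
      unfolding c_def[symmetric] \<rho>_def[symmetric]
    proof (intro equalityI subsetI)
      fix p assume "p \<in> cball c \<rho>"
      then obtain \<epsilon> where "cmod \<epsilon> \<le> 1" "p = (deriv ^^ n) (h_extr z0 \<gamma> n \<epsilon>) z0"
        unfolding disk_eq by auto
      then show "p \<in> {(deriv ^^ n) h z0 | h. h \<in> interpolants n z0 w0 w}"
        using extr(1) by blast
    next
      fix p assume "p \<in> {(deriv ^^ n) h z0 | h. h \<in> interpolants n z0 w0 w}"
      then show "p \<in> cball c \<rho>" using in_disk by blast
    qed
    fix h assume h: "h \<in> interpolants n z0 w0 w"
    obtain F where F: "schur_chain z0 \<gamma> n F" "\<And>z. cmod z < 1 \<Longrightarrow> h z = z * F 0 z"
      using chain[OF h] by blast
    have S: "F n \<in> class_S" using F(1) by (simp add: schur_chain_def)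
    show "\<exists>h' \<in> class_S. \<forall>z \<in> ball 0 1. h z = z * nest \<gamma> (Tm (- z0) z) (n - 1) (Tm (- z0) z * h' z)"
      using S F(2) nest[OF F(1)] by (intro bexI[of _ "F n"]) auto
    show "(deriv ^^ n) h z0 \<in> frontier (ball (cn' z0 w0 \<gamma> n) (rho' z0 w0 \<gamma> n)) \<longleftrightarrow>
          (\<exists>\<epsilon> \<in> frontier (ball 0 1). \<forall>z \<in> ball 0 1. h z = h_extr z0 \<gamma> n \<epsilon> z)"
      unfolding c_def[symmetric] \<rho>_def[symmetric] frontier_ball[OF \<rho>] frontier_ball[OF zero_less_one]
    proof
      assume "(deriv ^^ n) h z0 \<in> sphere c \<rho>"
      \<comment> \<open>A boundary value makes the last member unimodular at \<open>z0\<close>, and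
        the maximum modulus principle then makes it constant.\<close>
      then have uni: "cmod (F n z0) = 1"
        using dist[of "F n z0"] chain_deriv[OF F] \<rho> by simp
      have "h z = h_extr z0 \<gamma> n (F n z0) z" if "cmod z < 1" for z
        using F(2)[OF that] nest[OF F(1) that] class_S_constI[OF S z0(1) uni that]
        by (simp add: h_extr_def mult.commute)
      then show "\<exists>\<epsilon>\<in>sphere 0 1. \<forall>z\<in>ball 0 1. h z = h_extr z0 \<gamma> n \<epsilon> z"
        using uni by (intro bexI[of _ "F n z0"]) auto
    next
      assume "\<exists>\<epsilon>\<in>sphere 0 1. \<forall>z\<in>ball 0 1. h z = h_extr z0 \<gamma> n \<epsilon> z"
      then obtain \<epsilon> where \<epsilon>: "cmod \<epsilon> = 1" "\<And>z. z \<in> ball 0 1 \<Longrightarrow> h z = h_extr z0 \<gamma> n \<epsilon> z" by auto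
      \<comment> \<open>The functions agree on the disk only; as \<open>z0\<close> is an interior
        point, this suffices for the derivatives at \<open>z0\<close>.\<close>
      have "eventually (\<lambda>z. z \<in> ball 0 1) (nhds z0)"
        using assms(2) by (intro eventually_nhds_in_open) auto
      then have "eventually (\<lambda>z. h z = h_extr z0 \<gamma> n \<epsilon> z) (nhds z0)"
        by eventually_elim (rule \<epsilon>(2))
      then have "(deriv ^^ n) h z0 = (deriv ^^ n) (h_extr z0 \<gamma> n \<epsilon>) z0"
        by (rule higher_deriv_cong_ev) simp
      then show "(deriv ^^ n) h z0 \<in> sphere c \<rho>"
        using \<epsilon>(1) by (simp add: extr(2) dist)
    qed
  qed
qed

end
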